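(* Let $M$ be a purely 2-unrectifiable metric space. Given Lipschitz paths $\gamma:I\to M$ and $\beta:I\to M$ that are homotopic rel endpoints, there exist a Lipschitz map $H':I\times I\to M$ and a Lipschitz path $\beta':I\to M$ such that (1) the map $H'$ is a homotopy from $\gamma$ to $\beta'$; (2) $\operatorname{Lip}(H')=\operatorname{Lip}(\gamma)$; (3) $\operatorname{Im}(H')\subset\operatorname{Im}(\gamma)$; (4) $\operatorname{Lip}(\beta')\leq\operatorname{Lip}(\gamma)$; (5) $\operatorname{Im}(\beta')\subset\operatorname{Im}(\gamma)$; and (6) $\ell(\beta')\leq\ell(\beta)$.
   Context: $I=[0,1]$ with the Euclidean metric; all paths have domain $I$; $I\times I$ carries the $L^1$ metric $d^1((s,t),(s',t'))=|s-s'|+|t-t'|$. $\ell$ denotes the length of a path in $M$, and $\operatorname{Lip}(f)$ denotes the (smallest) Lipschitz constant of a Lipschitz map $f$. A metric space $M$ is purely 2-unrectifiable (in the sense of Ambrosio-Kirchheim) if for every Borel set $S\subset\mathbb{R}^2$ and every Lipschitz map $f:S\to M$, the 2-dimensional Hausdorff measure of $f(S)$ is zero. Two Lipschitz paths $\gamma,\gamma':I\to M$ are homotopic rel endpoints if $\gamma(0)=\gamma'(0)$, $\gamma(1)=\gamma'(1)$, and there is a Lipschitz map $H:I\times I\to M$ (a homotopy from $\gamma$ to $\gamma'$) with $H(t,0)=\gamma(t)$, $H(t,1)=\gamma'(t)$, $H(0,s)=\gamma(0)$, $H(1,s)=\gamma(1)$ for all $s,t\in I$. *)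

theory Defs
  imports "HOL-Analysis.Analysis"
begin

text \<open>The ambient metric space \<open>M\<close> is an arbitrary type \<open>'m\<close> of class \<^class>\<open>metric_space\<close>.
  Maps on the interval or the square are total functions, of which only the values on
  \<open>I\<close> respectively \<open>I \<times> I\<close> are ever used.\<close>

abbreviation unit_I :: "real set"
  where "unit_I \<equiv> {0..1}"

abbreviation unit_square :: "(real \<times> real) set"
  where "unit_square \<equiv> unit_I \<times> unit_I"

subsection \<open>Hausdorff measure and pure 2-unrectifiability\<close>

text \<open>The requirement \<^const>\<open>bounded\<close> is needed because \<^const>\<open>diameter\<close> is real-valued
  and hence meaningless for unbounded sets. The factor \<open>pi / 4\<close> is the usual normalisation
  (the area of a disc of diameter 1).\<close>

definition hausdorff2_pre :: "real \<Rightarrow> 'a::metric_space set \<Rightarrow> ennreal"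
  where "hausdorff2_pre \<delta> A =
    (INF E \<in> {E :: nat \<Rightarrow> 'a set.
        A \<subseteq> (\<Union>i. E i) \<and> (\<forall>i. bounded (E i) \<and> diameter (E i) \<le> \<delta>)}.
      \<Sum>i. ennreal (pi / 4 * (diameter (E i))\<^sup>2))"

definition hausdorff2 :: "'a::metric_space set \<Rightarrow> ennreal"
  where "hausdorff2 A = (SUP \<delta> \<in> {0<..}. hausdorff2_pre \<delta> A)"

text \<open>A property of the type \<open>'m\<close>, expressed through its whole carrier \<open>UNIV\<close>.\<close>

definition purely_2_unrectifiable :: "'m::metric_space itself \<Rightarrow> bool"
  where "purely_2_unrectifiable _ \<longleftrightarrow>
    (\<forall>(S :: (real ^ 2) set) (f :: real ^ 2 \<Rightarrow> 'm).
      S \<in> sets borel \<longrightarrow> (\<exists>C. C-lipschitz_on S f) \<longrightarrow> hausdorff2 (f ` S) = 0)"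

subsection \<open>Lipschitz maps and Lipschitz constants\<close>

text \<open>The library's \<^const>\<open>lipschitz_on\<close> uses the type class metric of the domain, which on
  \<open>real \<times> real\<close> is Euclidean. Since the square carries the \<open>L\<^sup>1\<close> metric, the metric
  of the domain is a parameter \<open>d\<close> here.\<close>

definition lipschitz_wrt ::
    "('a \<Rightarrow> 'a \<Rightarrow> real) \<Rightarrow> real \<Rightarrow> 'a set \<Rightarrow> ('a \<Rightarrow> 'b::metric_space) \<Rightarrow> bool"
  where "lipschitz_wrt d C S f \<longleftrightarrow>
    0 \<le> C \<and> (\<forall>x\<in>S. \<forall>y\<in>S. dist (f x) (f y) \<le> C * d x y)"

definition Lip_wrt :: "('a \<Rightarrow> 'a \<Rightarrow> real) \<Rightarrow> 'a set \<Rightarrow> ('a \<Rightarrow> 'b::metric_space) \<Rightarrow> real"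
  where "Lip_wrt d S f = Inf {C. lipschitz_wrt d C S f}"

definition d1 :: "real \<times> real \<Rightarrow> real \<times> real \<Rightarrow> real"
  where "d1 p q = \<bar>fst p - fst q\<bar> + \<bar>snd p - snd q\<bar>"

lemma lipschitz_wrt_dist: "lipschitz_wrt dist C S f \<longleftrightarrow> C-lipschitz_on S f"
  by (simp add: lipschitz_wrt_def lipschitz_on_def)

text \<open>The infimum is attained, so \<^const>\<open>Lip_wrt\<close> is the smallest Lipschitz constant.\<close>

lemma Lip_wrt_attained:
  assumes d: "\<And>x y. 0 \<le> d x y" and "lipschitz_wrt d C S f"
  shows "lipschitz_wrt d (Lip_wrt d S f) S f"
proof -
  let ?K = "{C. lipschitz_wrt d C S f}"
  have ne: "?K \<noteq> {}"
    using assms(2) by blast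
  have "dist (f x) (f y) \<le> Inf ?K * d x y" if "x \<in> S" "y \<in> S" for x y
  proof (cases "d x y = 0")
    case True
    then show ?thesis
      using assms(2) that by (force simp: lipschitz_wrt_def)
  next
    case False
    then have pos: "0 < d x y"
      using d[of x y] by simp
    have "dist (f x) (f y) / d x y \<le> Inf ?K"
      by (rule cInf_greatest[OF ne])
        (use that pos in \<open>auto simp: lipschitz_wrt_def pos_divide_le_eq\<close>)
    then show ?thesis
      using pos by (simp add: pos_divide_le_eq)
  qed
  moreover have "0 \<le> Inf ?K"
    by (rule cInf_greatest[OF ne]) (simp add: lipschitz_wrt_def)
  ultimately show ?thesis
    by (simp add: lipschitz_wrt_def Lip_wrt_def)
qed

definition lipschitz_path :: "(real \<Rightarrow> 'm::metric_space) \<Rightarrow> bool"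
  where "lipschitz_path \<gamma> \<longleftrightarrow> (\<exists>C. lipschitz_wrt dist C unit_I \<gamma>)"

definition lipschitz_square :: "(real \<times> real \<Rightarrow> 'm::metric_space) \<Rightarrow> bool"
  where "lipschitz_square H \<longleftrightarrow> (\<exists>C. lipschitz_wrt d1 C unit_square H)"

abbreviation Lip_path :: "(real \<Rightarrow> 'm::metric_space) \<Rightarrow> real"
  where "Lip_path \<gamma> \<equiv> Lip_wrt dist unit_I \<gamma>"

abbreviation Lip_square :: "(real \<times> real \<Rightarrow> 'm::metric_space) \<Rightarrow> real"
  where "Lip_square H \<equiv> Lip_wrt d1 unit_square H"

subsection \<open>Length of paths\<close>

definition curve_length :: "(real \<Rightarrow> 'm::metric_space) \<Rightarrow> ennreal"
  where "curve_length \<gamma> =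
    (SUP (n, t) \<in> {(n :: nat, t :: nat \<Rightarrow> real).
        t 0 = 0 \<and> t n = 1 \<and> (\<forall>i<n. t i \<le> t (Suc i))}.
      \<Sum>i<n. ennreal (dist (\<gamma> (t i)) (\<gamma> (t (Suc i)))))"

subsection \<open>Lipschitz homotopies rel endpoints\<close>

definition homotopy_from_to ::
    "(real \<times> real \<Rightarrow> 'm::metric_space) \<Rightarrow> (real \<Rightarrow> 'm) \<Rightarrow> (real \<Rightarrow> 'm) \<Rightarrow> bool"
  where "homotopy_from_to H \<gamma> \<gamma>' \<longleftrightarrow>
    lipschitz_square H \<and>
    (\<forall>t\<in>unit_I. H (t, 0) = \<gamma> t \<and> H (t, 1) = \<gamma>' t) \<and>
    (\<forall>s\<in>unit_I. H (0, s) = \<gamma> 0 \<and> H (1, s) = \<gamma> 1)"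

definition homotopic_rel_endpoints ::
    "(real \<Rightarrow> 'm::metric_space) \<Rightarrow> (real \<Rightarrow> 'm) \<Rightarrow> bool"
  where "homotopic_rel_endpoints \<gamma> \<gamma>' \<longleftrightarrow>
    \<gamma> 0 = \<gamma>' 0 \<and> \<gamma> 1 = \<gamma>' 1 \<and> (\<exists>H. homotopy_from_to H \<gamma> \<gamma>')"

end

theory Submission
  imports Defs
begin

text \<open>
  Let \<open>H\<close> be a homotopy from \<open>\<gamma>\<close> to \<open>\<beta>\<close> and \<open>K\<close> its image, so that the 2-dimensional Hausdorff
  measure of \<open>K\<close> vanishes. The pair of distances to two points maps \<open>K\<close> to a null set of the plane,
  so by Fubini almost every sphere of \<open>K\<close> is so thin that \<open>H\<close> is constant on every connected set
  mapped into finitely many such spheres. Covering \<open>K\<close> by balls bounded by thin spheres shows that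
  two continua \<open>X\<^sub>1\<close>, \<open>X\<^sub>2\<close> in the square are either joined by a connected part of a fibre of \<open>H\<close>, or
  separated by a connected set on which \<open>H\<close> is constant; in the second case any two continua
  connecting \<open>X\<^sub>1\<close> with \<open>X\<^sub>2\<close> are joined by a connected part of a fibre.

  Measure the distance of two points of the square by the least cost of a chain of pieces of the
  curves \<open>\<gamma>\<close> and \<open>\<beta>\<close> and of free jumps inside connected parts of fibres. The dichotomy above is
  exactly what yields the four-point condition, so \<open>\<gamma>\<close> runs in an \<open>\<real>\<close>-tree over \<open>M\<close>, where it can
  be contracted to the geodesic between its endpoints, whose length is at most that of \<open>\<beta>\<close>.
\<close>

section \<open>Paths in a real tree\<close>

lemma abs_max_diff_le:
  fixes a b c d e :: "'a::linordered_idom"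
  shows "\<bar>a - c\<bar> \<le> e \<Longrightarrow> \<bar>b - d\<bar> \<le> e \<Longrightarrow> \<bar>max a b - max c d\<bar> \<le> e"
  unfolding max_def by (auto simp: abs_le_iff)

lemma abs_min_diff_le:
  fixes a b c d e :: "'a::linordered_idom"
  shows "\<bar>a - c\<bar> \<le> e \<Longrightarrow> \<bar>b - d\<bar> \<le> e \<Longrightarrow> \<bar>min a b - min c d\<bar> \<le> e"
  unfolding min_def by (auto simp: abs_le_iff)

text \<open>The four-point condition makes the quotient of the line by \<open>\<rho>\<close>
  isometric to a subset of a real tree, and \<open>lip\<close> makes the line a Lipschitz path in
  that tree. Points of the tree are represented by parameters, hence only up to
  \<open>\<rho>\<close>-distance 0.\<close>

locale interval_tree =
  fixes \<rho> :: "real \<Rightarrow> real \<Rightarrow> real" and L :: real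
  assumes refl: "\<rho> s s = 0"
    and sym: "\<rho> s t = \<rho> t s"
    and tri: "\<rho> s u \<le> \<rho> s t + \<rho> t u"
    and lip: "\<rho> s t \<le> L * \<bar>s - t\<bar>"
    and four: "\<rho> x y + \<rho> z w \<le> max (\<rho> x z + \<rho> y w) (\<rho> x w + \<rho> y z)"
begin

lemma nonneg: "0 \<le> \<rho> s t"
  using tri[of s s t] refl[of s] sym[of s t] by simp

lemma L_nonneg: "0 \<le> L"
  using nonneg[of 0 1] lip[of 0 1] by simp

text \<open>The Gromov product with base point \<open>0\<close>.\<close>

definition gp :: "real \<Rightarrow> real \<Rightarrow> real"
  where "gp s t = (\<rho> 0 s + \<rho> 0 t - \<rho> s t) / 2"

lemma gp_sym: "gp s t = gp t s"
  by (simp add: gp_def sym)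

text \<open>This is the four-point condition for \<open>s\<close>, \<open>u\<close>,
  \<open>0\<close>, \<open>t\<close>, rewritten. Geometrically, \<open>gp s t\<close> is the height
  at which the geodesics from \<open>0\<close> to \<open>s\<close> and to \<open>t\<close>
  branch.\<close>

lemma gp_hyperbolic: "min (gp s t) (gp t u) \<le> gp s u"
  using four[of s u 0 t] sym[of 0 s] sym[of 0 t] sym[of 0 u] sym[of t u] unfolding gp_def by (simp add: max_def min_def split: if_splits)

lemma gp_le: "gp s t \<le> \<rho> 0 s"
  using tri[of 0 t s] sym[of s t] by (simp add: gp_def)

lemma gp_nonneg: "0 \<le> gp s t"
  using tri[of s t 0] sym[of 0 s] sym[of 0 t] by (simp add: gp_def)

lemma gp_diff_le: "\<bar>gp s t - gp s' t\<bar> \<le> \<rho> s s'"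
  using tri[of 0 s s'] tri[of 0 s' s] tri[of s t s'] tri[of s' t s] sym[of s' s]
  by (simp add: gp_def abs_le_iff field_simps)

lemma rho_diff_le: "\<bar>\<rho> 0 s - \<rho> 0 s'\<bar> \<le> \<rho> s s'"
  using tri[of 0 s s'] tri[of 0 s' s] sym[of s' s] by (simp add: abs_le_iff)

text \<open>The point sought is the first \<open>u\<close> at which \<open>gp u t\<close> reaches
  \<open>a\<close>. Were it higher than \<open>a\<close>, a slightly earlier parameter would qualify
  too, by \<open>gp_hyperbolic\<close>. So the path itself visits every point of the geodesic, which
  later keeps the homotopy inside the image of \<open>\<gamma>\<close>.\<close>

lemma geodesic_point:
  assumes t: "0 \<le> t" and a: "0 \<le> a" "a \<le> \<rho> 0 t"
  shows "\<exists>u\<in>{0..t}. \<rho> 0 u = a \<and> gp u t = a"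
proof -
  define S where "S = {u \<in> {0..t}. a \<le> gp u t}"
  define u where "u = Inf S"
  have gl: "\<bar>gp x t - gp y t\<bar> \<le> L * \<bar>x - y\<bar>" for x y
    using gp_diff_le[of x t y] lip[of x y] by linarith
  have "L-lipschitz_on UNIV (\<lambda>x. gp x t)"
    using gl L_nonneg by (intro lipschitz_onI) (auto simp: dist_real_def)
  then have "continuous_on UNIV (\<lambda>x. gp x t)"
    by (rule lipschitz_on_continuous_on)
  then have "closed {u. a \<le> gp u t}"
    by (intro closed_Collect_le) auto
  moreover have "S = {0..t} \<inter> {u. a \<le> gp u t}"
    by (auto simp: S_def)
  ultimately have "closed S"
    by auto
  moreover have "t \<in> S"
    using assms by (auto simp: S_def gp_def refl)
  moreover have bb: "bdd_below S"
    by (auto simp: S_def intro: bdd_belowI[of _ 0])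
  ultimately have uS: "u \<in> S"
    unfolding u_def by (intro closed_contains_Inf) auto
  have before: "gp x t < a" if "0 \<le> x" "x < u" for x
  proof (rule ccontr)
    assume "\<not> gp x t < a"
    then have "x \<in> S"
      using that uS by (auto simp: S_def)
    then show False
      using cInf_lower[OF _ bb] that by (force simp: u_def)
  qed
  have "\<rho> 0 u \<le> a"
  proof (cases "u = 0")
    case True
    then show ?thesis using a refl by simp
  next
    case False
    then have u0: "0 < u"
      using uS by (auto simp: S_def)
    show ?thesis
    proof (rule ccontr)
      assume "\<not> \<rho> 0 u \<le> a"
      \<comment> \<open>The first bound keeps \<open>u - e\<close> positive, the second makes
        \<open>L * e\<close> at most the excess height; dividing by \<open>L + 1\<close> covers the
        case \<open>L = 0\<close>.\<close>
      define e where "e = min (u / 2) ((\<rho> 0 u - a) / (L + 1))"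
      have e: "0 < e" "e < u" "e * (L + 1) \<le> \<rho> 0 u - a"
        using u0 L_nonneg \<open>\<not> \<rho> 0 u \<le> a\<close> pos_le_divide_eq[of "L + 1" e "\<rho> 0 u - a"]
        by (auto simp: e_def)
      then have "L * e \<le> \<rho> 0 u - a"
        by (simp add: algebra_simps)
      moreover have "\<rho> (u - e) u \<le> L * e"
        using lip[of "u - e" u] e by simp
      ultimately have "a \<le> gp (u - e) u"
        using rho_diff_le[of "u - e" u] by (simp add: gp_def)
      moreover have "a \<le> gp u t"
        using uS by (simp add: S_def)
      moreover have "gp (u - e) t < a"
        using before e by simp
      ultimately show False
        using gp_hyperbolic[of "u - e" u t] by linarith
    qed
  qed
  moreover have "a \<le> gp u t" "gp u t \<le> \<rho> 0 u"
    using uS gp_le by (auto simp: S_def)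
  ultimately show ?thesis
    using uS by (intro bexI[of _ u]) (auto simp: S_def)
qed

text \<open>The point at height \<open>a\<close> of the geodesic from \<open>0\<close> to \<open>t\<close>.\<close>

definition pt :: "real \<Rightarrow> real \<Rightarrow> real"
  where "pt t a = (SOME u. u \<in> {0..t} \<and> \<rho> 0 u = a \<and> gp u t = a)"

lemma pt:
  assumes "0 \<le> t" "0 \<le> a" "a \<le> \<rho> 0 t"
  shows "pt t a \<in> {0..t}" "\<rho> 0 (pt t a) = a" "gp (pt t a) t = a"
proof -
  have "\<exists>u. u \<in> {0..t} \<and> \<rho> 0 u = a \<and> gp u t = a"
    using geodesic_point[OF assms] by blast
  from someI_ex[OF this] show "pt t a \<in> {0..t}" "\<rho> 0 (pt t a) = a" "gp (pt t a) t = a"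
    by (auto simp: pt_def)
qed

text \<open>The geodesics to \<open>t\<close> and \<open>t'\<close> agree up to height
  \<open>gp t t'\<close>, so one can go from one point to the other through the common point at the
  height given by the minimum.\<close>

lemma rho_pt:
  assumes "0 \<le> t" "0 \<le> a" "a \<le> \<rho> 0 t" "0 \<le> t'" "0 \<le> a'" "a' \<le> \<rho> 0 t'"
  shows "\<rho> (pt t a) (pt t' a') \<le> a + a' - 2 * min a (min a' (gp t t'))"
proof -
  note p = pt[OF assms(1-3)] and p' = pt[OF assms(4-6)]
  have "min a (gp t t') \<le> gp (pt t a) t'"
    using gp_hyperbolic[of "pt t a" t t'] p by simp
  moreover have "min (gp (pt t a) t') a' \<le> gp (pt t a) (pt t' a')"
    using gp_hyperbolic[of "pt t a" t' "pt t' a'"] p' gp_sym[of t'] by simp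
  ultimately have "min a (min a' (gp t t')) \<le> gp (pt t a) (pt t' a')"
    by linarith
  then show ?thesis
    using p p' by (simp add: gp_def)
qed

lemma rho_pt_same:
  assumes "0 \<le> t" "0 \<le> a" "a \<le> \<rho> 0 t" "0 \<le> a'" "a' \<le> \<rho> 0 t"
  shows "\<rho> (pt t a) (pt t a') \<le> \<bar>a - a'\<bar>"
  using rho_pt[OF assms(1-3,1,4,5)] assms by (simp add: gp_def refl)

abbreviation "D \<equiv> \<rho> 0 1"

text \<open>Up to time \<open>1/2\<close> every point moves at speed \<open>L\<close> towards the geodesic from \<open>0\<close> to \<open>1\<close>; then it slides
  along that geodesic, again at speed \<open>L\<close>, towards its position in the parametrisation with constant
  speed. Both distances are at most \<open>L/2\<close>.\<close>

definition height1 :: "real \<Rightarrow> real \<Rightarrow> real"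
  where "height1 t s = max (gp t 1) (\<rho> 0 t - L * s)"

definition height2 :: "real \<Rightarrow> real \<Rightarrow> real"
  where "height2 t s = max (gp t 1 - L * (s - 1/2)) (min (gp t 1 + L * (s - 1/2)) (D * t))"

definition hpt :: "real \<Rightarrow> real \<Rightarrow> real"
  where "hpt t s = (if s \<le> 1/2 then pt t (height1 t s) else pt 1 (height2 t s))"

section \<open>Estimates for the contraction onto the geodesic from 0 to 1\<close>

lemma D_le: "D \<le> L"
  using lip[of 0 1] by simp

lemma gp_1_le: "gp t 1 \<le> D"
  using gp_le[of 1 t] gp_sym by simp

lemma height1_bounds: "0 \<le> s \<Longrightarrow> 0 \<le> height1 t s" "0 \<le> s \<Longrightarrow> height1 t s \<le> \<rho> 0 t"
  using gp_nonneg[of t 1] gp_le[of t 1] L_nonneg by (auto simp: height1_def)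

lemma height2_bounds:
  assumes "1/2 \<le> s" "t \<in> {0..1}"
  shows "0 \<le> height2 t s" "height2 t s \<le> D"
proof -
  have "0 \<le> L * (s - 1/2)" "0 \<le> D * t" "D * t \<le> D"
    using assms L_nonneg nonneg[of 0 1] by (auto intro: mult_left_le)
  then show "0 \<le> height2 t s" "height2 t s \<le> D"
    using gp_nonneg[of t 1] gp_1_le[of t] by (auto simp: height2_def)
qed

lemma hpt_in: "t \<in> {0..1} \<Longrightarrow> s \<in> {0..1} \<Longrightarrow> hpt t s \<in> {0..1}"
  using pt(1)[of t "height1 t s"] pt(1)[of 1 "height2 t s"] height1_bounds[of s t] height2_bounds[of s t]
  by (auto simp: hpt_def)

text \<open>The distance from \<open>t\<close> to the geodesic is
  \<open>\<rho> 0 t - gp t 1\<close>, half the excess of \<open>\<rho> 0 t + \<rho> t 1\<close> over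
  \<open>D\<close>, hence at most \<open>L / 2\<close>. A descent at speed \<open>L\<close> is
  therefore complete at time \<open>1/2\<close>.\<close>

lemma height1_half:
  assumes "t \<in> {0..1}"
  shows "height1 t (1/2) = gp t 1"
proof -
  have "\<rho> 0 t \<le> L * t" "\<rho> t 1 \<le> L * (1 - t)"
    using lip[of 0 t] lip[of t 1] assms by auto
  then have "\<rho> 0 t - L * (1/2) \<le> gp t 1"
    using nonneg[of 0 1] by (simp add: gp_def algebra_simps)
  then show ?thesis by (simp add: height1_def)
qed

text \<open>At time \<open>1/2\<close> both formulas select a representative of the branch point at
  height \<open>gp t 1\<close>. The two representatives may be different parameters, so only their
  distance vanishes.\<close>

lemma rho_glue:
  assumes "t \<in> {0..1}"
  shows "\<rho> (hpt t (1/2)) (pt 1 (height2 t (1/2))) = 0"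
proof -
  have "height2 t (1/2) = gp t 1"
    by (simp add: height2_def)
  moreover have "hpt t (1/2) = pt t (gp t 1)"
    using height1_half[OF assms] by (simp add: hpt_def)
  ultimately show ?thesis
    using rho_pt[of t "gp t 1" 1 "gp t 1"] gp_nonneg[of t 1] gp_le[of t 1] gp_1_le[of t] assms
      nonneg[of "pt t (gp t 1)" "pt 1 (gp t 1)"] by simp
qed

text \<open>Moving towards a geodesic does not expand distances. If the minimum in
  \<open>rho_pt\<close> is one of the heights, the bound is the difference of the heights; if it is
  \<open>gp t t'\<close>, the heights are at most \<open>\<rho> 0 t\<close> and
  \<open>\<rho> 0 t'\<close>, and the definition of \<open>gp\<close> gives
  \<open>\<rho> t t'\<close>.\<close>

lemma rho_hpt_t:
  assumes "t \<in> {0..1}" "t' \<in> {0..1}" "0 \<le> s" "s \<le> 1/2"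
  shows "\<rho> (hpt t s) (hpt t' s) \<le> L * \<bar>t - t'\<bar>"
proof -
  have "\<rho> (pt t (height1 t s)) (pt t' (height1 t' s)) \<le>
     height1 t s + height1 t' s - 2 * min (height1 t s) (min (height1 t' s) (gp t t'))"
    using assms height1_bounds by (intro rho_pt) auto
  also have "\<dots> \<le> \<rho> t t'"
  proof -
    have "\<bar>height1 t s - height1 t' s\<bar> \<le> \<rho> t t'"
      using gp_diff_le[of t 1 t'] rho_diff_le[of t t']
      unfolding height1_def by (intro abs_max_diff_le) linarith+
    moreover have "height1 t s + height1 t' s - 2 * gp t t' \<le> \<rho> t t'"
      using height1_bounds[of s t] height1_bounds[of s t'] assms
      by (simp add: gp_def field_simps)
    ultimately show ?thesis by linarith
  qed
  also have "\<dots> \<le> L * \<bar>t - t'\<bar>" by (rule lip)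
  finally show ?thesis using assms by (simp add: hpt_def)
qed

lemma rho_hpt_s:
  assumes "t \<in> {0..1}" "0 \<le> s" "s \<le> 1/2" "0 \<le> s'" "s' \<le> 1/2"
  shows "\<rho> (hpt t s) (hpt t s') \<le> L * \<bar>s - s'\<bar>"
proof -
  have "\<rho> (hpt t s) (hpt t s') \<le> \<bar>height1 t s - height1 t s'\<bar>"
    using assms height1_bounds unfolding hpt_def by (auto intro!: rho_pt_same)
  also have "\<dots> \<le> \<bar>L * s - L * s'\<bar>"
    unfolding height1_def by linarith
  also have "\<dots> = L * \<bar>s - s'\<bar>"
    using L_nonneg by (simp add: abs_mult flip: right_diff_distrib)
  finally show ?thesis .
qed

text \<open>\<open>height2\<close> clamps \<open>D * t\<close> to the interval of radius
  \<open>L * (s - 1/2)\<close> around \<open>gp t 1\<close>. Both ends of the interval and the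
  target \<open>D * t\<close> obey the bound, and maxima and minima preserve it.\<close>

lemma rho_pt_height2:
  assumes "t \<in> {0..1}" "1/2 \<le> s" "t' \<in> {0..1}" "1/2 \<le> s'"
  shows "\<rho> (pt 1 (height2 t s)) (pt 1 (height2 t' s')) \<le> L * (\<bar>t - t'\<bar> + \<bar>s - s'\<bar>)"
proof -
  have "\<rho> (pt 1 (height2 t s)) (pt 1 (height2 t' s')) \<le> \<bar>height2 t s - height2 t' s'\<bar>"
    using assms height2_bounds by (intro rho_pt_same) auto
  also have "\<dots> \<le> L * \<bar>t - t'\<bar> + L * \<bar>s - s'\<bar>"
  proof -
    have "\<bar>gp t 1 - gp t' 1\<bar> \<le> L * \<bar>t - t'\<bar>"
      using gp_diff_le[of t 1 t'] lip[of t t'] by linarith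
    moreover have "\<bar>L * s - L * s'\<bar> = L * \<bar>s - s'\<bar>"
      using L_nonneg by (simp add: abs_mult flip: right_diff_distrib)
    moreover have "\<bar>D * t - D * t'\<bar> \<le> L * \<bar>t - t'\<bar>"
      using D_le nonneg[of 0 1] by (simp add: abs_mult mult_right_mono flip: right_diff_distrib)
    moreover have "0 \<le> L * \<bar>s - s'\<bar>"
      using L_nonneg by simp
    ultimately show ?thesis
      unfolding height2_def right_diff_distrib
      by (intro abs_max_diff_le abs_min_diff_le) linarith+
  qed
  finally show ?thesis by (simp add: distrib_left)
qed

text \<open>The route through \<open>(t', s)\<close> and \<open>(t', 1/2)\<close> has legs that add
  up exactly to the \<open>d1\<close>-distance, so the gluing costs nothing in the constant.\<close>

lemma rho_hpt_ge_half:
  assumes "t \<in> {0..1}" "t' \<in> {0..1}" "0 \<le> s" "s \<le> 1/2" "1/2 < s'"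
  shows "\<rho> (hpt t s) (hpt t' s') \<le> L * (\<bar>t - t'\<bar> + \<bar>s - s'\<bar>)"
proof -
  let ?p = "pt 1 (height2 t' (1/2))"
  have 1: "\<rho> (hpt t s) (hpt t' s) \<le> L * \<bar>t - t'\<bar>"
    using assms by (intro rho_hpt_t)
  have 2: "\<rho> (hpt t' s) (hpt t' (1/2)) \<le> L * (1/2 - s)"
    using rho_hpt_s[of t' s "1/2"] assms by simp
  have 3: "\<rho> (hpt t' (1/2)) ?p = 0"
    using assms by (intro rho_glue)
  have 4: "\<rho> ?p (hpt t' s') \<le> L * (s' - 1/2)"
    using rho_pt_height2[of t' "1/2" t' s'] assms by (simp add: hpt_def)
  have "\<bar>s - s'\<bar> = (1/2 - s) + (s' - 1/2)"
    using assms by simp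
  then have "L * (\<bar>t - t'\<bar> + \<bar>s - s'\<bar>) = L * \<bar>t - t'\<bar> + L * (1/2 - s) + L * (s' - 1/2)"
    by (simp only: distrib_left)
  then show ?thesis
    using 1 2 3 4 tri[of "hpt t s" "hpt t' s'" "hpt t' s"]
      tri[of "hpt t' s" "hpt t' s'" "hpt t' (1/2)"] tri[of "hpt t' (1/2)" "hpt t' s'" ?p]
    by linarith
qed

lemma rho_hpt:
  assumes "t \<in> {0..1}" "t' \<in> {0..1}" "0 \<le> s" "0 \<le> s'"
  shows "\<rho> (hpt t s) (hpt t' s') \<le> L * (\<bar>t - t'\<bar> + \<bar>s - s'\<bar>)"
proof -
  consider "s \<le> 1/2" "s' \<le> 1/2" | "s \<le> 1/2" "1/2 < s'" | "1/2 < s" "s' \<le> 1/2" | "1/2 < s" "1/2 < s'"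
    by linarith
  then show ?thesis
  proof cases
    case 1
    then show ?thesis
      using rho_hpt_t[of t t' s] rho_hpt_s[of t' s s'] tri[of "hpt t s" "hpt t' s'" "hpt t' s"] assms
      by (simp add: distrib_left)
  next
    case 2
    then show ?thesis using rho_hpt_ge_half assms by blast
  next
    case 3
    then show ?thesis
      using rho_hpt_ge_half[of t' t s' s] assms sym[of "hpt t s"] by (simp add: abs_minus_commute)
  next
    case 4
    then show ?thesis
      using rho_pt_height2[of t s t' s'] assms by (simp add: hpt_def)
  qed
qed

lemma height2_1:
  assumes "t \<in> {0..1}"
  shows "height2 t 1 = D * t"
proof -
  have "gp t 1 \<le> L * t" "D - gp t 1 \<le> L * (1 - t)"
    using gp_le[of t 1] lip[of 0 t] gp_le[of 1 t] lip[of t 1] nonneg[of t 1] assms tri[of 0 1 t]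
      sym[of t 1] by (auto simp: gp_def field_simps)
  moreover have "D * t \<le> L * t" "D * (1 - t) \<le> L * (1 - t)" "0 \<le> D * t" "0 \<le> D * (1 - t)"
    using D_le assms nonneg[of 0 1] by (auto intro: mult_right_mono)
  moreover have "D * (1 - t) = D - D * t"
    by (simp add: right_diff_distrib)
  ultimately have "\<bar>gp t 1 - D * t\<bar> \<le> L * t" "\<bar>gp t 1 - D * t\<bar> \<le> L * (1 - t)"
    using gp_nonneg[of t 1] gp_1_le[of t] by linarith+
  \<comment> \<open>The two bounds add up to \<open>L\<close>, so the smaller is at most
    \<open>L / 2\<close>, which is the radius of the clamp at time 1: the target is reached.\<close>
  then have "\<bar>gp t 1 - D * t\<bar> \<le> L * (1 - 1/2)"
    by (simp add: right_diff_distrib)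
  then show ?thesis
    unfolding height2_def by linarith
qed

lemma rho_hpt_1:
  assumes "t \<in> {0..1}" "t' \<in> {0..1}"
  shows "\<rho> (hpt t 1) (hpt t' 1) \<le> D * \<bar>t - t'\<bar>"
proof -
  have "\<rho> (hpt t 1) (hpt t' 1) \<le> \<bar>D * t - D * t'\<bar>"
    using assms height2_bounds[of 1 t] height2_bounds[of 1 t'] height2_1[of t] height2_1[of t']
    unfolding hpt_def by (auto intro!: rho_pt_same)
  also have "\<dots> = D * \<bar>t - t'\<bar>"
    using nonneg[of 0 1] by (simp add: abs_mult flip: right_diff_distrib)
  finally show ?thesis .
qed

lemma rho_hpt_0: "t \<in> {0..1} \<Longrightarrow> \<rho> (hpt t 0) t = 0"
proof -
  assume "t \<in> {0..1}"
  then have "gp (pt t (\<rho> 0 t)) t = \<rho> 0 t" "\<rho> 0 (pt t (\<rho> 0 t)) = \<rho> 0 t"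
    using pt nonneg by auto
  then have "\<rho> (pt t (\<rho> 0 t)) t = 0"
    by (simp add: gp_def)
  then show ?thesis
    using gp_le[of t 1] by (simp add: hpt_def height1_def max_absorb2)
qed

lemma rho_hpt_left:
  assumes "s \<in> {0..1}"
  shows "\<rho> (hpt 0 s) 0 = 0"
proof -
  have g: "gp 0 1 = 0"
    by (simp add: gp_def refl)
  have "height1 0 s = 0"
    using assms L_nonneg by (simp add: height1_def g refl)
  moreover have "1/2 \<le> s \<Longrightarrow> height2 0 s = 0"
    using L_nonneg by (simp add: height2_def g)
  ultimately show ?thesis
    using pt(2)[of 0 0] pt(2)[of 1 0] nonneg[of 0 1] sym[of 0] by (auto simp: hpt_def refl)
qed

lemma rho_hpt_right:
  assumes "s \<in> {0..1}"
  shows "\<rho> (hpt 1 s) 1 = 0"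
proof -
  have g: "gp 1 1 = D"
    by (simp add: gp_def refl)
  have "height1 1 s = D"
    using assms L_nonneg by (simp add: height1_def g refl)
  moreover have "1/2 \<le> s \<Longrightarrow> height2 1 s = D"
    using L_nonneg by (simp add: height2_def g)
  ultimately show ?thesis
    using pt(2,3)[of 1 D] nonneg[of 0 1] by (auto simp: hpt_def gp_def)
qed

text \<open>By the hypothesis \<open>\<gamma>\<close> factors through the tree as a 1-Lipschitz map,
  so \<open>\<gamma>\<close> applied to \<open>hpt\<close> inherits all estimates. The final path
  has the constant \<open>D\<close>, the distance of the endpoints in the tree, and this will bound
  its length.\<close>

theorem exists_homotopy_to_geodesic:
  fixes \<gamma> :: "real \<Rightarrow> 'm::metric_space"
  assumes \<gamma>: "\<And>s t. s \<in> unit_I \<Longrightarrow> t \<in> unit_I \<Longrightarrow> dist (\<gamma> s) (\<gamma> t) \<le> \<rho> s t"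
  shows "\<exists>H. lipschitz_wrt d1 L unit_square H \<and> H ` unit_square \<subseteq> \<gamma> ` unit_I \<and>
    homotopy_from_to H \<gamma> (\<lambda>t. H (t, 1)) \<and> lipschitz_wrt dist D unit_I (\<lambda>t. H (t, 1))"
proof -
  define H where "H = (\<lambda>(t, s). \<gamma> (hpt t s))"
  have lipH: "lipschitz_wrt d1 L unit_square H"
    unfolding lipschitz_wrt_def
  proof safe
    show "0 \<le> L" by (rule L_nonneg)
    fix t s t' s' :: real
    assume ts: "t \<in> unit_I" "s \<in> unit_I" "t' \<in> unit_I" "s' \<in> unit_I"
    then have "dist (H (t, s)) (H (t', s')) \<le> \<rho> (hpt t s) (hpt t' s')"
      unfolding H_def by (simp only: prod.case) (intro \<gamma> hpt_in)
    also have "\<dots> \<le> L * (\<bar>t - t'\<bar> + \<bar>s - s'\<bar>)"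
      using ts by (intro rho_hpt) auto
    finally show "dist (H (t, s)) (H (t', s')) \<le> L * d1 (t, s) (t', s')"
      by (simp add: d1_def)
  qed
  \<comment> \<open>Different representatives of a point of the tree have the same image under
    \<open>\<gamma>\<close>; this turns the vanishing distances at the sides into
    equalities.\<close>
  have eqI: "\<gamma> u = \<gamma> v" if "u \<in> unit_I" "v \<in> unit_I" "\<rho> u v = 0" for u v
    using \<gamma>[OF that(1,2)] that(3) by simp
  have "homotopy_from_to H \<gamma> (\<lambda>t. H (t, 1))"
    unfolding homotopy_from_to_def lipschitz_square_def
    using lipH eqI[OF hpt_in _ rho_hpt_0] eqI[OF hpt_in _ rho_hpt_left] eqI[OF hpt_in _ rho_hpt_right]
    by (auto simp: H_def)
  moreover have "H ` unit_square \<subseteq> \<gamma> ` unit_I"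
    using hpt_in by (auto simp: H_def)
  moreover have "lipschitz_wrt dist D unit_I (\<lambda>t. H (t, 1))"
    unfolding lipschitz_wrt_def
  proof safe
    show "0 \<le> D" by (rule nonneg)
    fix t t' :: real
    assume t: "t \<in> unit_I" "t' \<in> unit_I"
    then have "dist (H (t, 1)) (H (t', 1)) \<le> \<rho> (hpt t 1) (hpt t' 1)"
      unfolding H_def by (simp only: prod.case) (intro \<gamma> hpt_in, auto)
    also have "\<dots> \<le> D * dist t t'"
      using rho_hpt_1[OF t] by (simp add: dist_real_def)
    finally show "dist (H (t, 1)) (H (t', 1)) \<le> D * dist t t'" .
  qed
  ultimately show ?thesis using lipH by blast
qed

end

section \<open>Thin spheres\<close>

text \<open>Both coordinates are 1-Lipschitz, so a set of diameter \<open>d\<close> is mapped into a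
  square of side \<open>2 * d\<close>. Its area is at most 6 times the term
  \<open>pi / 4 * d\<^sup>2\<close> of the Hausdorff sum, because \<open>pi > 3\<close>. Covers at
  scale 1 already have arbitrarily small sums.\<close>

lemma null_sets_dist_image:
  fixes K :: "'m::metric_space set"
  assumes K: "compact K" and null: "hausdorff2 K = 0"
  shows "(\<lambda>y. (dist m y, dist a y)) ` K \<in> null_sets lborel"
proof -
  let ?g = "\<lambda>y. (dist m y, dist a y) :: real \<times> real"
  have "compact (?g ` K)"
    using K by (intro compact_continuous_image continuous_intros)
  then have meas: "?g ` K \<in> sets lborel"
    using borel_compact by auto
  have pre: "hausdorff2_pre 1 K = 0"
    using null SUP_upper[of 1 "{0<..}" "\<lambda>\<delta>. hausdorff2_pre \<delta> K"]
    by (simp add: hausdorff2_def)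
  have eps: "emeasure lborel (?g ` K) \<le> 0 + ennreal e" if e: "0 < e" for e
  proof -
    have "hausdorff2_pre 1 K < ennreal (e / 6)"
      using e pre by simp
    then obtain E where E: "K \<subseteq> (\<Union>i. E i)" "\<And>i. bounded (E i)"
      and sumE: "(\<Sum>i. ennreal (pi / 4 * (diameter (E i))\<^sup>2)) < ennreal (e / 6)"
      unfolding hausdorff2_pre_def INF_less_iff by blast
    \<comment> \<open>The square is centred at the image of an arbitrary point of
      \<open>E i\<close>; an empty \<open>E i\<close> has no such point and gets the empty
      set.\<close>
    define B where "B i = (if E i = {} then {} else
        let x = (SOME x. x \<in> E i); d = diameter (E i)
        in cbox (dist m x - d, dist a x - d) (dist m x + d, dist a x + d))" for i
    have B: "?g ` E i \<subseteq> B i \<and> emeasure lborel (B i) \<le> 6 * ennreal (pi / 4 * (diameter (E i))\<^sup>2)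
        \<and> B i \<in> sets lborel" for i
    proof (cases "E i = {}")
      case False
      define x where "x = (SOME x. x \<in> E i)"
      define d where "d = diameter (E i)"
      have x: "x \<in> E i"
        using False unfolding x_def by (simp add: some_in_eq)
      have Beq: "B i = cbox (dist m x - d, dist a x - d) (dist m x + d, dist a x + d)"
        using False by (simp add: B_def x_def d_def Let_def)
      have d0: "0 \<le> d"
        using E(2) by (simp add: d_def diameter_ge_0)
      have "?g y \<in> B i" if "y \<in> E i" for y
      proof -
        have "dist x y \<le> d"
          unfolding d_def using diameter_bounded_bound[OF E(2) x that] .
        then have "\<bar>dist m x - dist m y\<bar> \<le> d" "\<bar>dist a x - dist a y\<bar> \<le> d"
          using abs_dist_diff_le[of x m y] abs_dist_diff_le[of x a y] by (simp_all add: dist_commute)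
        then show ?thesis
          unfolding Beq cbox_Pair_eq by (simp add: abs_le_iff)
      qed
      moreover have "emeasure lborel (B i) = ennreal ((2 * d) * (2 * d))"
      proof -
        have "B i = cbox (dist m x - d) (dist m x + d) \<times> cbox (dist a x - d) (dist a x + d)"
          by (simp add: Beq cbox_Pair_eq)
        then have "emeasure lborel (B i) = ennreal (2 * d) * ennreal (2 * d)"
          using d0 by (simp add: lborel.emeasure_pair_measure_Times flip: lborel_prod)
        then show ?thesis
          using d0 by (simp only: ennreal_mult mult_nonneg_nonneg zero_le_numeral)
      qed
      moreover have "(2 * d) * (2 * d) \<le> 6 * (pi / 4 * d\<^sup>2)"
      proof -
        have "3 * (d * d) \<le> pi * (d * d)"
          using pi_gt3 by (intro mult_right_mono) auto
        moreover have "0 \<le> d * d"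
          by simp
        ultimately show ?thesis
          unfolding power2_eq_square by linarith
      qed
      moreover have "6 * ennreal (pi / 4 * d\<^sup>2) = ennreal (6 * (pi / 4 * d\<^sup>2))"
        by (subst ennreal_mult) auto
      moreover have "B i \<in> sets lborel"
        by (simp add: Beq)
      ultimately show ?thesis
        unfolding d_def[symmetric] by (simp only: image_subset_iff) (blast intro: ennreal_leI)
    qed (simp add: B_def)
    have "emeasure lborel (?g ` K) \<le> emeasure lborel (\<Union>i. B i)"
    proof (rule emeasure_mono)
      show "?g ` K \<subseteq> (\<Union>i. B i)"
      proof safe
        fix y assume "y \<in> K"
        then obtain i where "y \<in> E i"
          using E(1) by blast
        then have "?g y \<in> B i"
          using B[of i] by blast
        then show "?g y \<in> (\<Union>i. B i)"
          by blast
      qed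
      show "(\<Union>i. B i) \<in> sets lborel"
        using B by (intro sets.countable_UN) auto
    qed
    also have "\<dots> \<le> (\<Sum>i. emeasure lborel (B i))"
    proof (rule emeasure_subadditive_countably)
      show "range B \<subseteq> sets lborel"
        using B by blast
    qed
    also have "\<dots> \<le> (\<Sum>i. 6 * ennreal (pi / 4 * (diameter (E i))\<^sup>2))"
    proof (rule suminf_le)
      show "emeasure lborel (B i) \<le> 6 * ennreal (pi / 4 * (diameter (E i))\<^sup>2)" for i
        using B by blast
    qed simp_all
    also have "\<dots> = 6 * (\<Sum>i. ennreal (pi / 4 * (diameter (E i))\<^sup>2))"
      by simp
    also have "\<dots> \<le> 6 * ennreal (e / 6)"
      using sumE by (intro mult_left_mono) auto
    also have "\<dots> = ennreal e"
      using e by (simp flip: ennreal_numeral ennreal_mult)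
    finally show ?thesis by simp
  qed
  have "emeasure lborel (?g ` K) \<le> 0"
    by (rule ennreal_le_epsilon) (rule eps)
  then show ?thesis
    using meas by auto
qed

text \<open>A substitute for vanishing one-dimensional measure of the sphere, tested only by
  distance functions to points of \<open>A\<close>.\<close>

definition thin_sphere :: "'m::metric_space set \<Rightarrow> 'm set \<Rightarrow> 'm \<Rightarrow> real \<Rightarrow> bool"
  where "thin_sphere K A m r \<longleftrightarrow> (\<forall>a\<in>A. dist a ` (K \<inter> sphere m r) \<in> null_sets lborel)"

text \<open>Fubini: the slice at \<open>r\<close> of the planar null set is the set of distances
  from \<open>a\<close> to the sphere of radius \<open>r\<close>, so it is null for almost every
  \<open>r\<close>. Countability of \<open>A\<close> gives one exceptional null set, which cannot
  contain an interval.\<close>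

lemma exists_thin_sphere:
  fixes K :: "'m::metric_space set"
  assumes K: "compact K" and null: "hausdorff2 K = 0" and A: "countable A" and e: "0 < e"
  shows "\<exists>r. 0 < r \<and> r < e \<and> thin_sphere K A m r"
proof -
  have "AE r in lborel. \<forall>a\<in>A. dist a ` (K \<inter> sphere m r) \<in> null_sets lborel"
  proof (rule AE_ball_countable')
    fix a
    let ?G = "(\<lambda>y. (dist m y, dist a y)) ` K"
    have "AE p in lborel. p \<notin> ?G"
      using null_sets_dist_image[OF K null] by (rule AE_not_in)
    then have "AE r in lborel. AE s in lborel. (r, s) \<notin> ?G"
      unfolding lborel_prod[symmetric] by (rule lborel_pair.AE_pair)
    then show "AE r in lborel. dist a ` (K \<inter> sphere m r) \<in> null_sets lborel"
    proof (rule AE_mp, intro AE_I2 impI)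
      fix r assume *: "AE s in lborel. (r, s) \<notin> ?G"
      have eq: "s \<in> dist a ` (K \<inter> sphere m r) \<longleftrightarrow> (r, s) \<in> ?G" for s
        by auto
      \<comment> \<open>Compactness of the slice supplies the measurability needed to pass from
        almost everywhere to a null set.\<close>
      have "closed (sphere m r)"
        unfolding sphere_def by (intro closed_Collect_eq continuous_intros)
      then have "compact (dist a ` (K \<inter> sphere m r))"
        using K by (intro compact_continuous_image continuous_intros compact_Int_closed)
      then have "dist a ` (K \<inter> sphere m r) \<in> sets lborel"
        using borel_compact by auto
      then show "dist a ` (K \<inter> sphere m r) \<in> null_sets lborel"
        using * by (simp add: AE_iff_null_sets eq)
    qed
  qed (use A in auto)
  then obtain N where N: "N \<in> null_sets lborel"
    "{r. \<not> thin_sphere K A m r} \<subseteq> N"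
    unfolding thin_sphere_def eventually_ae_filter by auto
  have "\<not> {0<..<e} \<subseteq> N"
  proof
    assume "{0<..<e} \<subseteq> N"
    then have "emeasure lborel {0<..<e} \<le> emeasure lborel N"
      using N(1) by (intro emeasure_mono) auto
    then show False
      using N(1) e by (simp add: null_setsD1)
  qed
  then show ?thesis
    using N(2) by auto
qed

text \<open>A point \<open>a\<close> of \<open>A\<close> close to \<open>x\<close> is nearer to
  \<open>x\<close> than to \<open>y\<close>, so the distances from \<open>a\<close> to points of
  \<open>B\<close> fill a nondegenerate interval. But they lie in a finite union of null
  sets.\<close>

lemma connected_in_thin_spheres:
  fixes B :: "'m::metric_space set"
  assumes S: "finite S" "\<And>m r. (m, r) \<in> S \<Longrightarrow> thin_sphere K A m r"
    and dense: "K \<subseteq> closure A"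
    and B: "connected B" "B \<subseteq> K" "B \<subseteq> (\<Union>(m, r)\<in>S. sphere m r)"
    and xy: "x \<in> B" "y \<in> B"
  shows "x = y"
proof (rule ccontr)
  assume "x \<noteq> y"
  then have "0 < dist x y / 2" by simp
  moreover have "x \<in> closure A" using xy B dense by blast
  ultimately obtain a where a: "a \<in> A" "dist a x < dist x y / 2"
    unfolding closure_approachable by blast
  have "dist a x < dist a y"
    using a(2) dist_triangle[of x y a] dist_commute[of x a] by linarith
  have "connected (dist a ` B)"
    using B by (intro connected_continuous_image continuous_intros)
  then have "{dist a x..dist a y} \<subseteq> dist a ` B"
    using xy by (intro connected_contains_Icc) auto
  also have "\<dots> \<subseteq> (\<Union>(m, r)\<in>S. dist a ` (K \<inter> sphere m r))"
  proof
    fix t assume "t \<in> dist a ` B"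
    then obtain z where z: "z \<in> B" "t = dist a z" by blast
    then obtain m r where "(m, r) \<in> S" "z \<in> sphere m r"
      using B(3) by blast
    moreover have "z \<in> K" using z(1) B(2) by blast
    ultimately show "t \<in> (\<Union>(m, r)\<in>S. dist a ` (K \<inter> sphere m r))"
      unfolding z(2) by blast
  qed
  finally have sub: "{dist a x..dist a y} \<subseteq> (\<Union>(m, r)\<in>S. dist a ` (K \<inter> sphere m r))" .
  have "(\<Union>(m, r)\<in>S. dist a ` (K \<inter> sphere m r)) \<in> null_sets lborel"
    using S a(1) by (intro null_sets_UN' countable_finite) (auto simp: thin_sphere_def)
  then have "emeasure lborel {dist a x..dist a y} = 0"
    using emeasure_mono[OF sub, of lborel] by (metis le_zero_eq null_setsD1 null_setsD2)
  then show False
    using \<open>dist a x < dist a y\<close> by simp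
qed

lemma compact_countable_dense:
  fixes K :: "'m::metric_space set"
  assumes "compact K"
  obtains A where "countable A" "K \<subseteq> closure A"
proof -
  have "\<exists>T. finite T \<and> K \<subseteq> (\<Union>x\<in>T. ball x (inverse (real (Suc n))))" for n
  proof -
    have "K \<subseteq> (\<Union>x\<in>UNIV. ball x (inverse (real (Suc n))))"
    proof
      fix x assume "x \<in> K"
      show "x \<in> (\<Union>x\<in>UNIV. ball x (inverse (real (Suc n))))"
        by (rule UN_I[of x]) (simp_all del: of_nat_Suc)
    qed
    then show ?thesis
      using compactE_image[OF assms, of UNIV "\<lambda>x. ball x (inverse (real (Suc n)))"] by (metis open_ball)
  qed
  then obtain T where T: "\<And>n. finite (T n)" "\<And>n. K \<subseteq> (\<Union>x\<in>T n. ball x (inverse (real (Suc n))))"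
    by metis
  show thesis
  proof (rule that[of "\<Union>n. T n"])
    show "countable (\<Union>n. T n)"
      using T by (intro countable_UN) (simp_all add: countable_finite)
    show "K \<subseteq> closure (\<Union>n. T n)"
    proof
      fix x assume "x \<in> K"
      show "x \<in> closure (\<Union>n. T n)"
        unfolding closure_approachable
      proof safe
        fix e :: real assume "0 < e"
        then obtain n where "inverse (real (Suc n)) < e"
          using reals_Archimedean by blast
        moreover obtain y where "y \<in> T n" "dist y x < inverse (real (Suc n))"
          using subsetD[OF T(2)[of n] \<open>x \<in> K\<close>] unfolding UN_iff mem_ball by (elim bexE)
        ultimately show "\<exists>y\<in>\<Union>n. T n. dist y x < e"
          by (intro bexI[of _ y]) auto
      qed
    qed
  qed
qed

section \<open>Joining and separating continua\<close>

text \<open>Components of a compact set have small clopen neighbourhoods (Sura-Bura). Components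
  through \<open>A\<close> miss \<open>B\<close>, hence so do suitable clopen neighbourhoods, and
  finitely many of these cover \<open>P \<inter> A\<close>.\<close>

lemma compact_separation_between:
  fixes P :: "'a::euclidean_space set"
  assumes P: "compact P" and "closed A" "closed B"
    and no: "\<And>C. compact C \<Longrightarrow> connected C \<Longrightarrow> C \<subseteq> P \<Longrightarrow> C \<inter> A \<noteq> {} \<Longrightarrow> C \<inter> B = {}"
  obtains U V where "compact U" "compact V" "U \<union> V = P" "U \<inter> V = {}" "P \<inter> A \<subseteq> U" "P \<inter> B \<subseteq> V"
proof -
  have "\<exists>W. open W \<and> a \<in> W \<and> compact (P \<inter> W) \<and> P \<inter> W \<inter> B = {}" if a: "a \<in> P \<inter> A" for a
  proof -
    define C where "C = connected_component_set P a"
    have C: "C \<in> components P" "a \<in> C"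
      using a by (auto simp: C_def components_def connected_component_refl)
    then have "compact C" "connected C" "C \<subseteq> P"
      using P by (auto simp: compact_components in_components_connected in_components_subset)
    moreover from this have "C \<inter> B = {}"
      using no a C by blast
    ultimately obtain K where K: "openin (top_of_set P) K" "compact K" "C \<subseteq> K" "K \<subseteq> - B"
      using Sura_Bura_clopen_subset[of P C "- B"] C P \<open>closed B\<close>
      by (metis closed_imp_locally_compact compact_imp_closed disjoint_eq_subset_Compl open_Compl)
    then obtain W where "open W" "K = P \<inter> W"
      by (auto simp: openin_open)
    then show ?thesis
      using K C by (intro exI[of _ W]) auto
  qed
  then obtain W where W: "\<And>a. a \<in> P \<inter> A \<Longrightarrow> open (W a) \<and> a \<in> W a \<and> compact (P \<inter> W a) \<and> P \<inter> W a \<inter> B = {}"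
    by metis
  have "compact (P \<inter> A)"
    using P \<open>closed A\<close> by (rule compact_Int_closed)
  moreover have "P \<inter> A \<subseteq> (\<Union>a\<in>P \<inter> A. W a)"
    using W by blast
  ultimately obtain T where T: "T \<subseteq> P \<inter> A" "finite T" "P \<inter> A \<subseteq> (\<Union>a\<in>T. W a)"
    using W by (metis compactE_image)
  define U where "U = (\<Union>a\<in>T. P \<inter> W a)"
  have "compact U"
    unfolding U_def using T W by (intro compact_UN) auto
  moreover have "compact (P - (\<Union>a\<in>T. W a))"
    using T W P by (intro compact_diff open_UN) auto
  ultimately show thesis
    using T W by (intro that[of U "P - (\<Union>a\<in>T. W a)"]) (auto simp: U_def)
qed

definition fibre_joined :: "('a::topological_space \<Rightarrow> 'b) \<Rightarrow> 'a set \<Rightarrow> 'a set \<Rightarrow> 'a set \<Rightarrow> bool"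
  where "fibre_joined F Q A B \<longleftrightarrow>
    (\<exists>C\<subseteq>Q. compact C \<and> connected C \<and> F constant_on C \<and> C \<inter> A \<noteq> {} \<and> C \<inter> B \<noteq> {})"

text \<open>The fibre over \<open>m\<close> splits into a part containing its points in
  \<open>X1\<close> and a part containing those in \<open>X2\<close>. By compactness disjoint
  neighbourhoods of the two parts still serve for the preimage of a small ball.\<close>

lemma small_preimage_splits:
  fixes F :: "'a::euclidean_space \<Rightarrow> 'm::metric_space"
  assumes F: "continuous_on Q F" and Q: "compact Q"
    and X: "closed X1" "closed X2" "X1 \<subseteq> Q" "X2 \<subseteq> Q"
    and nj: "\<not> fibre_joined F Q X1 X2"
  obtains e O1 O2 where "0 < e" "open O1" "open O2" "O1 \<inter> O2 = {}"
    "\<And>z. z \<in> Q \<Longrightarrow> dist m (F z) < e \<Longrightarrow> z \<in> O1 \<union> O2"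
    "\<And>z. z \<in> X1 \<Longrightarrow> dist m (F z) < e \<Longrightarrow> z \<in> O1"
    "\<And>z. z \<in> X2 \<Longrightarrow> dist m (F z) < e \<Longrightarrow> z \<in> O2"
proof -
  define P where "P = {z \<in> Q. F z = m}"
  have "closed P"
    unfolding P_def using continuous_closed_preimage_constant[OF F] Q compact_imp_closed
    by (metis (no_types, lifting))
  then have P: "compact P"
    using Q by (metis (no_types, lifting) P_def closed_Int_compact inf.absorb1 mem_Collect_eq subsetI)
  have "C \<inter> X2 = {}" if "compact C" "connected C" "C \<subseteq> P" "C \<inter> X1 \<noteq> {}" for C
  proof (rule ccontr)
    assume "C \<inter> X2 \<noteq> {}"
    moreover have "F constant_on C" "C \<subseteq> Q"
      using that(3) by (auto simp: P_def constant_on_def intro!: exI[of _ m])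
    ultimately show False
      using nj that unfolding fibre_joined_def by blast
  qed
  then obtain U V where UV: "compact U" "compact V" "U \<union> V = P" "U \<inter> V = {}"
      "P \<inter> X1 \<subseteq> U" "P \<inter> X2 \<subseteq> V"
    using compact_separation_between[OF P X(1,2)] by metis
  obtain O1 O2 where O: "open O1" "open O2" "U \<subseteq> O1" "V \<subseteq> O2" "O1 \<inter> O2 = {}"
    using separation_normal_compact[OF UV(1) compact_imp_closed[OF UV(2)]] UV(4)
    by (metis UV(1,2) compact_imp_closed separation_normal)
  \<comment> \<open>All points violating one of the three required inclusions. The set is compact
    and misses the fibre, so its image stays away from \<open>m\<close>.\<close>
  define N where "N = (Q - (O1 \<union> O2)) \<union> (Q \<inter> X1 - O1) \<union> (Q \<inter> X2 - O2)"
  have "compact N"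
    unfolding N_def using Q X O by (intro compact_Un compact_diff compact_Int_closed open_Un)
  have NP: "F z \<noteq> m" if "z \<in> N" for z
    using that UV O unfolding N_def P_def by blast
  have "\<exists>e>0. \<forall>z\<in>N. e \<le> dist m (F z)"
  proof (cases "N = {}")
    case True
    then show ?thesis by (auto intro: exI[of _ 1])
  next
    case False
    have "continuous_on N (\<lambda>z. dist m (F z))"
      by (intro continuous_intros continuous_on_subset[OF F]) (auto simp: N_def)
    from continuous_attains_inf[OF \<open>compact N\<close> False this]
    obtain z where "z \<in> N" "\<forall>y\<in>N. dist m (F z) \<le> dist m (F y)" by blast
    then show ?thesis
      using NP by (intro exI[of _ "dist m (F z)"]) auto
  qed
  then obtain e where e: "e > 0" "\<And>z. z \<in> N \<Longrightarrow> e \<le> dist m (F z)" by blast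
  show thesis
  proof (rule that[OF e(1) O(1,2,5)])
    fix z assume z: "dist m (F z) < e"
    then have "z \<notin> N" using e by force
    then show "z \<in> Q \<Longrightarrow> z \<in> O1 \<union> O2" "z \<in> X1 \<Longrightarrow> z \<in> O1" "z \<in> X2 \<Longrightarrow> z \<in> O2"
      using X unfolding N_def by auto
  qed
qed

lemma constant_on_closure:
  fixes F :: "'a::topological_space \<Rightarrow> 'b::t1_space"
  assumes "continuous_on (closure C) F" "F constant_on C"
  shows "F constant_on closure C"
  using assms continuous_constant_on_closure[of C F] unfolding constant_on_def by (metis image_closure_subset)

text \<open>Finitely many balls with good boundary spheres cut \<open>Q\<close> into closed sets
  \<open>R1\<close> around \<open>X1\<close> and \<open>R2\<close> around \<open>X2\<close> that
  meet only over these spheres. One component of the interface already separates \<open>X1\<close>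
  from \<open>X2\<close>, and \<open>F\<close> is constant on it by \<open>const\<close>. The
  retraction \<open>\<kappa>\<close> transfers the argument to the whole Euclidean space.\<close>

theorem fibre_joined_or_separated:
  fixes F :: "'a::euclidean_space \<Rightarrow> 'm::metric_space"
  assumes F: "continuous_on Q F" and Q: "compact Q"
    and \<kappa>: "continuous_on UNIV \<kappa>" "range \<kappa> \<subseteq> Q" "\<And>x. x \<in> Q \<Longrightarrow> \<kappa> x = x"
    and good: "\<And>m e. 0 < e \<Longrightarrow> \<exists>r. 0 < r \<and> r < e \<and> good m r"
    and const: "\<And>C S. finite S \<Longrightarrow> connected C \<Longrightarrow> C \<subseteq> Q \<Longrightarrow>
       (\<And>m r. (m, r) \<in> S \<Longrightarrow> good m r) \<Longrightarrow>
       (\<And>z. z \<in> C \<Longrightarrow> \<exists>(m, r)\<in>S. dist m (F z) = r) \<Longrightarrow> F constant_on C"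
    and X: "compact X1" "compact X2" "connected X1" "connected X2" "X1 \<subseteq> Q" "X2 \<subseteq> Q"
    and ne: "X1 \<noteq> {}" "X2 \<noteq> {}"
    and nj: "\<not> fibre_joined F Q X1 X2"
  obtains C where "compact C" "connected C" "C \<subseteq> Q" "F constant_on C"
    "\<And>X. connected X \<Longrightarrow> X \<subseteq> Q \<Longrightarrow> X \<inter> X1 \<noteq> {} \<Longrightarrow> X \<inter> X2 \<noteq> {} \<Longrightarrow> X \<inter> C \<noteq> {}"
proof -
  have "\<forall>m. \<exists>r O1 O2. 0 < r \<and> good m r \<and> open O1 \<and> open O2 \<and> O1 \<inter> O2 = {} \<and>
      (\<forall>z\<in>Q. dist m (F z) \<le> r \<longrightarrow> z \<in> O1 \<union> O2) \<and>
      (\<forall>z\<in>X1. dist m (F z) \<le> r \<longrightarrow> z \<in> O1) \<and> (\<forall>z\<in>X2. dist m (F z) \<le> r \<longrightarrow> z \<in> O2)"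
  proof
    fix m
    obtain e O1 O2 where e: "0 < e" "open O1" "open O2" "O1 \<inter> O2 = {}"
      "\<And>z. z \<in> Q \<Longrightarrow> dist m (F z) < e \<Longrightarrow> z \<in> O1 \<union> O2"
      "\<And>z. z \<in> X1 \<Longrightarrow> dist m (F z) < e \<Longrightarrow> z \<in> O1"
      "\<And>z. z \<in> X2 \<Longrightarrow> dist m (F z) < e \<Longrightarrow> z \<in> O2"
      using small_preimage_splits[OF F Q _ _ X(5,6) nj] X compact_imp_closed by metis
    obtain r where "0 < r" "r < e" "good m r"
      using good e(1) by blast
    then show "\<exists>r O1 O2. 0 < r \<and> good m r \<and> open O1 \<and> open O2 \<and> O1 \<inter> O2 = {} \<and>
      (\<forall>z\<in>Q. dist m (F z) \<le> r \<longrightarrow> z \<in> O1 \<union> O2) \<and>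
      (\<forall>z\<in>X1. dist m (F z) \<le> r \<longrightarrow> z \<in> O1) \<and> (\<forall>z\<in>X2. dist m (F z) \<le> r \<longrightarrow> z \<in> O2)"
      using e by (intro exI[of _ r] exI[of _ O1] exI[of _ O2]) auto
  qed
  then obtain r O1 O2 where r: "\<And>m. 0 < r m" "\<And>m. good m (r m)"
    and O: "\<And>m. open (O1 m)" "\<And>m. open (O2 m)" "\<And>m. O1 m \<inter> O2 m = {}"
      "\<And>m z. z \<in> Q \<Longrightarrow> dist m (F z) \<le> r m \<Longrightarrow> z \<in> O1 m \<union> O2 m"
      "\<And>m z. z \<in> X1 \<Longrightarrow> dist m (F z) \<le> r m \<Longrightarrow> z \<in> O1 m"
      "\<And>m z. z \<in> X2 \<Longrightarrow> dist m (F z) \<le> r m \<Longrightarrow> z \<in> O2 m"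
    by metis
  have "compact (F ` Q)"
    using F Q by (rule compact_continuous_image)
  moreover have "F ` Q \<subseteq> (\<Union>m\<in>UNIV. ball m (r m))"
  proof
    fix y assume "y \<in> F ` Q"
    show "y \<in> (\<Union>m\<in>UNIV. ball m (r m))"
      by (rule UN_I[of y]) (simp_all add: r(1))
  qed
  ultimately obtain T where T: "finite T" "F ` Q \<subseteq> (\<Union>m\<in>T. ball m (r m))"
    using compactE_image[of "F ` Q" UNIV "\<lambda>m. ball m (r m)"] open_ball by metis
  obtain ms where ms: "set ms = T"
    using finite_list[OF T(1)] by blast
  define n where "n = length ms"
  \<comment> \<open>Two of the closed sets \<open>P i\<close> meet only over thin spheres, and each splits into a part near \<open>X1\<close> and
    a part near \<open>X2\<close>.\<close>
  define P where "P i = {z \<in> Q. dist (ms ! i) (F z) \<le> r (ms ! i) \<and>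
     (\<forall>j<i. r (ms ! j) \<le> dist (ms ! j) (F z))}" for i
  have closedP: "closed (P i)" for i
  proof -
    have eq: "P i = (Q \<inter> (\<lambda>z. dist (ms ! i) (F z)) -` {..r (ms ! i)}) \<inter>
        (\<Inter>j\<in>{..<i}. Q \<inter> (\<lambda>z. dist (ms ! j) (F z)) -` {r (ms ! j)..})"
      by (auto simp: P_def)
    have cl: "closed (Q \<inter> (\<lambda>z. dist (ms ! j) (F z)) -` B)" if "closed B" for j B
      by (rule continuous_closed_preimage[OF _ compact_imp_closed[OF Q] that]) (intro continuous_intros F)
    show ?thesis
      unfolding eq by (intro closed_Int[OF cl closed_INT] ballI cl) simp_all
  qed
  have coverP: "\<exists>i<n. z \<in> P i" if "z \<in> Q" for z
  proof -
    \<comment> \<open>The first ball containing the image of \<open>z\<close> in its interior; all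
      earlier ones satisfy the reverse inequality, as \<open>P i\<close> demands.\<close>
    define i where "i = (LEAST i. i < n \<and> dist (ms ! i) (F z) < r (ms ! i))"
    have "\<exists>m\<in>set ms. dist m (F z) < r m"
      using subsetD[OF T(2) imageI[OF that]] ms by simp
    then have "\<exists>i. i < n \<and> dist (ms ! i) (F z) < r (ms ! i)"
      by (auto simp: in_set_conv_nth n_def)
    then have i: "i < n" "dist (ms ! i) (F z) < r (ms ! i)"
      unfolding i_def by (metis (mono_tags, lifting) LeastI)+
    moreover have "r (ms ! j) \<le> dist (ms ! j) (F z)" if "j < i" for j
      using not_less_Least[of j] that i(1) unfolding i_def by fastforce
    ultimately show ?thesis
      using that by (auto simp: P_def)
  qed
  \<comment> \<open>\<open>P i\<close> lies in the disjoint union of \<open>O1\<close> and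
    \<open>O2\<close>, so removing \<open>O2\<close> leaves its part near \<open>X1\<close> and
    removing \<open>O1\<close> its part near \<open>X2\<close>.\<close>
  define R1 where "R1 = (\<Union>i<n. P i - O2 (ms ! i))"
  define R2 where "R2 = (\<Union>i<n. P i - O1 (ms ! i))"
  have closedR: "closed R1" "closed R2"
    unfolding R1_def R2_def using closedP O by (auto intro!: closed_UN closed_Diff)
  have RQ: "R1 \<union> R2 = Q"
  proof (intro equalityI subsetI)
    fix z assume "z \<in> Q"
    then obtain i where i: "i < n" "z \<in> P i"
      using coverP by blast
    moreover have "z \<notin> O1 (ms ! i) \<or> z \<notin> O2 (ms ! i)"
      using O(3)[of "ms ! i"] by blast
    ultimately show "z \<in> R1 \<union> R2"
      unfolding R1_def R2_def by blast
  qed (auto simp: R1_def R2_def P_def)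
  have XR: "X1 \<inter> R2 = {}" "X2 \<inter> R1 = {}"
    unfolding R1_def R2_def P_def using O(5,6) by blast+
  \<comment> \<open>The two parts of the same \<open>P i\<close> are disjoint, so \<open>z\<close>
    belongs to \<open>P i\<close> and \<open>P j\<close> with different indices. For the smaller
    index the two inequalities give equality.\<close>
  have sphere: "\<exists>i<n. dist (ms ! i) (F z) = r (ms ! i)" if z: "z \<in> R1 \<inter> R2" for z
  proof -
    obtain i j where ij: "i < n" "z \<in> P i" "z \<notin> O2 (ms ! i)" "j < n" "z \<in> P j" "z \<notin> O1 (ms ! j)"
      using z by (auto simp: R1_def R2_def)
    then have "i \<noteq> j"
      using O(4) by (auto simp: P_def)
    then consider "i < j" | "j < i"
      by linarith
    then show ?thesis
    proof cases
      case 1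
      then show ?thesis using ij by (auto simp: P_def intro!: exI[of _ i] antisym)
    next
      case 2
      then show ?thesis using ij by (auto simp: P_def intro!: exI[of _ j] antisym)
    qed
  qed
  define Z where "Z = \<kappa> -` (R1 \<inter> R2)"
  have cl\<kappa>: "closed (\<kappa> -` B)" if "closed B" for B
    using that \<kappa>(1) by (simp add: continuous_closed_vimage continuous_on_eq_continuous_at)
  have "closed Z"
    unfolding Z_def using closedR by (intro cl\<kappa>) auto
  obtain x1 x2 where x: "x1 \<in> X1" "x2 \<in> X2"
    using ne by auto
  have "\<not> connected_component (- Z) x1 x2"
  proof
    assume "connected_component (- Z) x1 x2"
    then obtain Y where Y: "connected Y" "Y \<subseteq> - Z" "x1 \<in> Y" "x2 \<in> Y"
      by (auto simp: connected_component_def)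
    have "Y \<subseteq> \<kappa> -` R1 \<union> \<kappa> -` R2"
      using RQ \<kappa>(2) by auto
    moreover have "\<kappa> -` R1 \<inter> \<kappa> -` R2 \<inter> Y = {}"
      using Y(2) by (auto simp: Z_def)
    ultimately have "\<kappa> -` R1 \<inter> Y = {} \<or> \<kappa> -` R2 \<inter> Y = {}"
      using Y(1) cl\<kappa> closedR unfolding connected_closed by metis
    moreover have "x1 \<in> \<kappa> -` R1" "x2 \<in> \<kappa> -` R2"
      using x X(5,6) XR RQ \<kappa>(3) by auto
    ultimately show False
      using Y by blast
  qed
  \<comment> \<open>In Euclidean space, if a closed set separates two points, then one of its
    components already does.\<close>
  then obtain C where C: "C \<in> components Z" "\<not> connected_component (- C) x1 x2"
    using separation_by_component_closed_pointwise[OF \<open>closed Z\<close>] by metis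
  have CZ: "connected C" "C \<subseteq> Z"
    using in_components_connected[OF C(1)] in_components_subset[OF C(1)] by auto
  \<comment> \<open>\<open>C\<close> can be unbounded, so its image under \<open>\<kappa>\<close>
    need not be closed; constancy of \<open>F\<close> survives the closure by continuity.\<close>
  define C' where "C' = closure (\<kappa> ` C)"
  have \<kappa>C: "connected (\<kappa> ` C)" "\<kappa> ` C \<subseteq> Q"
    using CZ \<kappa> by (auto intro!: connected_continuous_image intro: continuous_on_subset)
  then have C'Q: "C' \<subseteq> Q"
    unfolding C'_def using Q by (simp add: closure_minimal compact_imp_closed)
  have "F constant_on (\<kappa> ` C)"
  proof (rule const[of "(\<lambda>m. (m, r m)) ` T"])
    show "\<exists>(m, r)\<in>(\<lambda>m. (m, r m)) ` T. dist m (F z) = r" if "z \<in> \<kappa> ` C" for z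
      using sphere[of z] that CZ(2) ms by (force simp: Z_def n_def)
  qed (use T r \<kappa>C in auto)
  then have "F constant_on C'"
    unfolding C'_def using C'Q F by (intro constant_on_closure) (auto simp: C'_def intro: continuous_on_subset)
  moreover have "compact C'"
    using C'Q Q by (metis C'_def closed_closure closed_Int_compact inf.absorb1)
  moreover have "connected C'"
    using \<kappa>C(1) by (simp add: C'_def connected_imp_connected_closure)
  moreover have "Y \<inter> C' \<noteq> {}"
    if Y: "connected Y" "Y \<subseteq> Q" "Y \<inter> X1 \<noteq> {}" "Y \<inter> X2 \<noteq> {}" for Y
  proof
    assume "Y \<inter> C' = {}"
    have "Y \<inter> C = {}"
    proof (rule ccontr)
      assume "Y \<inter> C \<noteq> {}"
      then obtain y where "y \<in> Y" "y \<in> C" by auto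
      then have "\<kappa> y \<in> C'" "\<kappa> y = y"
        using closure_subset[of "\<kappa> ` C"] \<kappa>(3) Y(2) by (auto simp: C'_def)
      then show False
        using \<open>y \<in> Y\<close> \<open>Y \<inter> C' = {}\<close> by auto
    qed
    moreover have "\<kappa> x = x" if "x \<in> X1 \<union> X2" for x
      using that X(5,6) \<kappa>(3) by blast
    then have "X1 \<inter> Z = {}" "X2 \<inter> Z = {}"
      using XR by (auto simp: Z_def disjoint_iff)
    \<comment> \<open>A continuum avoiding \<open>C'\<close> would link \<open>x1\<close> to
      \<open>x2\<close> outside \<open>C\<close> by way of \<open>X1\<close> and
      \<open>X2\<close>.\<close>
    ultimately have "X1 \<union> Y \<union> X2 \<subseteq> - C"
      using CZ(2) by auto
    moreover have "connected (X1 \<union> Y \<union> X2)"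
      using Y X by (intro connected_Un) auto
    ultimately have "connected_component (- C) x1 x2"
      unfolding connected_component_def using x by blast
    then show False using C(2) by blast
  qed
  ultimately show thesis
    using C'Q by (intro that[of C']) auto
qed

section \<open>The tree of connected parts of fibres\<close>

text \<open>The weight \<open>w i\<close> acts as an arc length of the image of \<open>c i\<close>
  under \<open>F\<close>: its increments bound distances. In \<open>four_sets\<close> the continua
  meet like the sides of a quadrilateral, with \<open>X1\<close>, \<open>X2\<close> and
  \<open>X3\<close>, \<open>X4\<close> as opposite pairs.\<close>

locale chain_space =
  fixes F :: "'a::euclidean_space \<Rightarrow> 'm::metric_space" and Q :: "'a set"
    and c :: "'i \<Rightarrow> real \<Rightarrow> 'a" and w :: "'i \<Rightarrow> real \<Rightarrow> real"
  assumes continuous_c: "continuous_on unit_I (c i)"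
    and c_in: "t \<in> unit_I \<Longrightarrow> c i t \<in> Q"
    and dist_c: "s \<in> unit_I \<Longrightarrow> t \<in> unit_I \<Longrightarrow> s \<le> t \<Longrightarrow>
      dist (F (c i s)) (F (c i t)) \<le> w i t - w i s"
    and four_sets: "(\<And>X. X \<in> {X1, X2, X3, X4} \<Longrightarrow> compact X \<and> connected X \<and> X \<subseteq> Q) \<Longrightarrow>
      X1 \<inter> X3 \<noteq> {} \<Longrightarrow> X1 \<inter> X4 \<noteq> {} \<Longrightarrow> X2 \<inter> X3 \<noteq> {} \<Longrightarrow> X2 \<inter> X4 \<noteq> {} \<Longrightarrow>
      fibre_joined F Q X1 X2 \<or> fibre_joined F Q X3 X4"
begin

lemma w_mono: "s \<in> unit_I \<Longrightarrow> t \<in> unit_I \<Longrightarrow> s \<le> t \<Longrightarrow> w i s \<le> w i t"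
  using dist_c[of s t i] zero_le_dist[of "F (c i s)" "F (c i t)"] by linarith

text \<open>The third argument is the trace of the chain, recorded because \<open>four_sets\<close>
  speaks of continua; the fourth is its cost.\<close>

inductive chain :: "'a \<Rightarrow> 'a \<Rightarrow> 'a set \<Rightarrow> real \<Rightarrow> bool" where
  segment: "s \<in> unit_I \<Longrightarrow> t \<in> unit_I \<Longrightarrow>
    chain (c i s) (c i t) (c i ` closed_segment s t) \<bar>w i s - w i t\<bar>"
| jump: "compact C \<Longrightarrow> connected C \<Longrightarrow> C \<subseteq> Q \<Longrightarrow> F constant_on C \<Longrightarrow> x \<in> C \<Longrightarrow> y \<in> C \<Longrightarrow> chain x y C 0"
| trans: "chain x y X l \<Longrightarrow> chain y z Y k \<Longrightarrow> chain x z (X \<union> Y) (l + k)"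

lemma segment_subset: "s \<in> unit_I \<Longrightarrow> t \<in> unit_I \<Longrightarrow> closed_segment s t \<subseteq> unit_I"
  by (simp add: closed_segment_subset)

lemma chain_set: "chain x y X l \<Longrightarrow> compact X \<and> connected X \<and> X \<subseteq> Q \<and> x \<in> X \<and> y \<in> X"
proof (induction rule: chain.induct)
  case (segment s t i)
  then have sub: "closed_segment s t \<subseteq> unit_I"
    by (rule segment_subset)
  then have "continuous_on (closed_segment s t) (c i)"
    using continuous_c continuous_on_subset by blast
  then show ?case
    using sub c_in by (auto intro!: compact_continuous_image connected_continuous_image)
next
  case (trans x y X l z Y k)
  then show ?case
    by (auto intro: connected_Un)
qed auto

lemma chain_dist: "chain x y X l \<Longrightarrow> dist (F x) (F y) \<le> l"
proof (induction rule: chain.induct)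
  case (segment s t i)
  then show ?case
    using dist_c[of s t i] dist_c[of t s i] by (cases "s \<le> t") (auto simp: dist_commute)
next
  case (jump C x y)
  then show ?case by (auto simp: constant_on_def)
next
  case (trans x y X l z Y k)
  then show ?case using dist_triangle[of "F x" "F z" "F y"] by linarith
qed

lemma chain_sym: "chain x y X l \<Longrightarrow> chain y x X l"
proof (induction rule: chain.induct)
  case (segment s t i)
  then show ?case
    using chain.segment[of t s i] by (simp add: closed_segment_commute abs_minus_commute)
next
  case (jump C x y)
  then show ?case by (intro chain.jump)
next
  case (trans x y X l z Y k)
  then show ?case using chain.trans[of z y Y k x X l] by (simp add: Un_commute add.commute)
qed

text \<open>Monotonicity of \<open>w i\<close> makes the cost of a segment additive under cutting,
  and a free jump can be interrupted at any point of its continuum.\<close>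

lemma chain_split:
  "chain x y X l \<Longrightarrow> p \<in> X \<Longrightarrow> \<exists>Y Z k m. chain x p Y k \<and> chain p y Z m \<and> k + m = l"
proof (induction arbitrary: p rule: chain.induct)
  case (segment s t i)
  then obtain u where u: "u \<in> closed_segment s t" "p = c i u"
    by blast
  then have uI: "u \<in> unit_I"
    using segment_subset segment by blast
  have "\<bar>w i s - w i u\<bar> + \<bar>w i u - w i t\<bar> = \<bar>w i s - w i t\<bar>"
  proof (cases "s \<le> t")
    case True
    then show ?thesis
      using u uI segment w_mono[of s u i] w_mono[of u t i] by (auto simp: closed_segment_eq_real_ivl)
  next
    case False
    then show ?thesis
      using u uI segment w_mono[of t u i] w_mono[of u s i] by (auto simp: closed_segment_eq_real_ivl)
  qed
  moreover have "chain (c i s) p (c i ` closed_segment s u) \<bar>w i s - w i u\<bar>"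
    "chain p (c i t) (c i ` closed_segment u t) \<bar>w i u - w i t\<bar>"
    unfolding u(2) using segment uI by (auto intro: chain.segment)
  ultimately show ?case by blast
next
  case (jump C x y)
  then have "chain x p C 0" "chain p y C 0"
    by (auto intro: chain.jump)
  then show ?case by force
next
  case (trans x y X l z Y k)
  show ?case
  proof (cases "p \<in> X")
    case True
    then obtain Y' Z' k' m' where "chain x p Y' k'" "chain p y Z' m'" "k' + m' = l"
      using trans.IH(1) by blast
    moreover from this have "chain p z (Z' \<union> Y) (m' + k)"
      using trans.hyps(2) by (intro chain.trans)
    ultimately show ?thesis
      by (metis add.assoc)
  next
    case False
    then obtain Y' Z' k' m' where "chain y p Y' k'" "chain p z Z' m'" "k' + m' = k"
      using trans.IH(2) trans.prems by blast
    moreover from this have "chain x p (X \<union> Y') (l + k')"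
      using trans.hyps(1) by (intro chain.trans)
    ultimately show ?thesis
      by (metis add.assoc)
  qed
qed

text \<open>The value is meaningful only for points linked by a chain, since otherwise the infimum
  is over the empty set; hence the chain hypotheses below.\<close>

definition rho :: "'a \<Rightarrow> 'a \<Rightarrow> real"
  where "rho x y = Inf {l. \<exists>X. chain x y X l}"

lemma rho_le: "chain x y X l \<Longrightarrow> rho x y \<le> l"
  unfolding rho_def
  by (rule cInf_lower) (auto intro!: bdd_belowI[of _ 0] dest: chain_dist order_trans[OF zero_le_dist])

lemma rho_approx:
  assumes "chain x y X l" "0 < e"
  obtains Y k where "chain x y Y k" "k < rho x y + e"
proof -
  have "{l. \<exists>X. chain x y X l} \<noteq> {}" "Inf {l. \<exists>X. chain x y X l} < rho x y + e"
    using assms by (auto simp: rho_def)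
  from cInf_lessD[OF this] show thesis
    using that by blast
qed

lemma dist_le_rho:
  assumes "chain x y X l"
  shows "dist (F x) (F y) \<le> rho x y"
  unfolding rho_def using assms by (intro cInf_greatest) (auto dest: chain_dist)

lemma rho_sym: "rho x y = rho y x"
  unfolding rho_def using chain_sym by metis

lemma chain_refl: "x \<in> Q \<Longrightarrow> chain x x {x} 0"
  by (rule jump) (auto simp: constant_on_def)

lemma rho_refl: "x \<in> Q \<Longrightarrow> rho x x = 0"
  using rho_le[OF chain_refl] dist_le_rho[OF chain_refl] by fastforce

lemma rho_triangle:
  assumes "chain x y X l" "chain y z Y k"
  shows "rho x z \<le> rho x y + rho y z"
proof (rule field_le_epsilon)
  fix e :: real assume "0 < e"
  then obtain X' l' Y' k' where "chain x y X' l'" "l' < rho x y + e / 2"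
      "chain y z Y' k'" "k' < rho y z + e / 2"
    using rho_approx[OF assms(1), of "e / 2"] rho_approx[OF assms(2), of "e / 2"] by (metis half_gt_zero)
  then show "rho x z \<le> rho x y + rho y z + e"
    using rho_le[OF chain.trans, of x y X' l' z Y' k'] by linarith
qed

text \<open>Cut both chains where the joining continuum meets them and exchange their ends across
  it: the jump is free, so the total cost is unchanged.\<close>

lemma rho_joined:
  assumes "chain x z X1 l1" "chain y w' X2 l2" "fibre_joined F Q X1 X2"
  shows "rho x y + rho z w' \<le> l1 + l2"
proof -
  obtain C p q where C: "compact C" "connected C" "C \<subseteq> Q" "F constant_on C"
      "p \<in> C" "p \<in> X1" "q \<in> C" "q \<in> X2"
    using assms(3) unfolding fibre_joined_def by blast
  obtain Y1 Z1 k1 m1 where 1: "chain x p Y1 k1" "chain p z Z1 m1" "k1 + m1 = l1"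
    using chain_split[OF assms(1) C(6)] by blast
  obtain Y2 Z2 k2 m2 where 2: "chain y q Y2 k2" "chain q w' Z2 m2" "k2 + m2 = l2"
    using chain_split[OF assms(2) C(8)] by blast
  have pq: "chain p q C 0"
    using C by (intro jump)
  have "rho x y \<le> k1 + (0 + k2)"
    by (rule rho_le, rule chain.trans[OF 1(1) chain.trans[OF pq chain_sym[OF 2(1)]]])
  moreover have "rho z w' \<le> m1 + (0 + m2)"
    by (rule rho_le, rule chain.trans[OF chain_sym[OF 1(2)] chain.trans[OF pq 2(2)]])
  ultimately show ?thesis
    using 1 2 by linarith
qed

text \<open>Almost optimal chains between the four points form a closed quadrilateral, sharing an
  endpoint at each corner. One opposite pair is joined inside a fibre, and \<open>rho_joined\<close>
  applies to it.\<close>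

lemma rho_four_points:
  assumes "chain x z X1 l1" "chain y v X2 l2" "chain x v X3 l3" "chain y z X4 l4"
  shows "rho x y + rho z v \<le> max (rho x z + rho y v) (rho x v + rho y z)"
proof (rule field_le_epsilon)
  fix e :: real assume "0 < e"
  then have e2: "0 < e / 2" by simp
  obtain Y1 k1 where 1: "chain x z Y1 k1" "k1 < rho x z + e / 2"
    using rho_approx[OF assms(1) e2] by blast
  obtain Y2 k2 where 2: "chain y v Y2 k2" "k2 < rho y v + e / 2"
    using rho_approx[OF assms(2) e2] by blast
  obtain Y3 k3 where 3: "chain x v Y3 k3" "k3 < rho x v + e / 2"
    using rho_approx[OF assms(3) e2] by blast
  obtain Y4 k4 where 4: "chain y z Y4 k4" "k4 < rho y z + e / 2"
    using rho_approx[OF assms(4) e2] by blast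
  have "fibre_joined F Q Y1 Y2 \<or> fibre_joined F Q Y3 Y4"
    using chain_set[OF 1(1)] chain_set[OF 2(1)] chain_set[OF 3(1)] chain_set[OF 4(1)]
    by (intro four_sets) auto
  then have "rho x y + rho z v \<le> k1 + k2 \<or> rho x y + rho z v \<le> k3 + k4"
    using rho_joined[OF 1(1) 2(1)] rho_joined[OF 3(1) 4(1)] rho_sym[of v z] by auto
  then show "rho x y + rho z v \<le> max (rho x z + rho y v) (rho x v + rho y z) + e"
    using 1(2) 2(2) 3(2) 4(2) by linarith
qed

text \<open>The nonexpansive projection of the line onto the unit interval makes the pseudometric
  total. All points lie on the one curve \<open>c i\<close>, so its segments provide the chains
  required.\<close>

lemma interval_tree_rho:
  assumes w: "\<And>t. t \<in> unit_I \<Longrightarrow> w i t = L * t"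
  defines "\<pi> \<equiv> \<lambda>t. c i (max 0 (min 1 t))"
  shows "interval_tree (\<lambda>s t. rho (\<pi> s) (\<pi> t)) L"
proof -
  have proj: "max 0 (min 1 t) \<in> unit_I" for t :: real
    by auto
  have ch: "chain (\<pi> s) (\<pi> t) (c i ` closed_segment (max 0 (min 1 s)) (max 0 (min 1 t)))
      \<bar>w i (max 0 (min 1 s)) - w i (max 0 (min 1 t))\<bar>" for s t
    unfolding \<pi>_def by (intro segment proj)
  show ?thesis
  proof
    fix s t u x y z v :: real
    show "rho (\<pi> s) (\<pi> s) = 0"
      unfolding \<pi>_def by (intro rho_refl c_in proj)
    show "rho (\<pi> s) (\<pi> t) = rho (\<pi> t) (\<pi> s)"
      by (rule rho_sym)
    show "rho (\<pi> s) (\<pi> u) \<le> rho (\<pi> s) (\<pi> t) + rho (\<pi> t) (\<pi> u)"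
      using ch by (intro rho_triangle)
    show "rho (\<pi> x) (\<pi> y) + rho (\<pi> z) (\<pi> v) \<le>
        max (rho (\<pi> x) (\<pi> z) + rho (\<pi> y) (\<pi> v)) (rho (\<pi> x) (\<pi> v) + rho (\<pi> y) (\<pi> z))"
      using ch by (intro rho_four_points)
    have "0 \<le> L"
      using w_mono[of 0 1 i] w[of 0] w[of 1] by simp
    have "rho (\<pi> s) (\<pi> t) \<le> \<bar>L * max 0 (min 1 s) - L * max 0 (min 1 t)\<bar>"
      using rho_le[OF ch[of s t]] w[OF proj] by simp
    also have "\<dots> = L * \<bar>max 0 (min 1 s) - max 0 (min 1 t)\<bar>"
      using \<open>0 \<le> L\<close> by (simp add: abs_mult flip: right_diff_distrib)
    also have "\<dots> \<le> L * \<bar>s - t\<bar>"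
      using \<open>0 \<le> L\<close> by (intro mult_left_mono) auto
    finally show "rho (\<pi> s) (\<pi> t) \<le> L * \<bar>s - t\<bar>" .
  qed
qed

end

section \<open>Length of curves and conclusion\<close>

text \<open>If \<open>X1\<close> and \<open>X2\<close> are not joined in a fibre, a connected set on
  which \<open>F\<close> is constant separates them. \<open>X3\<close> and \<open>X4\<close> both
  run from \<open>X1\<close> to \<open>X2\<close>, so both meet it, and it joins them.\<close>

lemma four_sets_of_null_image:
  fixes F :: "'a::euclidean_space \<Rightarrow> 'm::metric_space"
  assumes F: "continuous_on (cbox a b) F" and null: "hausdorff2 (F ` cbox a b) = 0"
    and X: "\<And>X. X \<in> {X1, X2, X3, X4} \<Longrightarrow> compact X \<and> connected X \<and> X \<subseteq> cbox a b"
    and meet: "X1 \<inter> X3 \<noteq> {}" "X1 \<inter> X4 \<noteq> {}" "X2 \<inter> X3 \<noteq> {}" "X2 \<inter> X4 \<noteq> {}"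
  shows "fibre_joined F (cbox a b) X1 X2 \<or> fibre_joined F (cbox a b) X3 X4"
proof (subst disj_commute, rule disjCI)
  let ?Q = "cbox a b"
  assume nj: "\<not> fibre_joined F ?Q X1 X2"
  have K: "compact (F ` ?Q)"
    by (intro compact_continuous_image F compact_cbox)
  obtain A where A: "countable A" "F ` ?Q \<subseteq> closure A"
    using compact_countable_dense[OF K] .
  have "?Q \<noteq> {}"
    using X[of X1] meet(1) by auto
  then have clamp: "range (clamp a b) \<subseteq> ?Q"
    by (auto simp: box_ne_empty intro!: clamp_in_interval)
  have cont: "continuous_on UNIV (clamp a b)"
    using clamp_continuous_on[of a b "\<lambda>x. x" UNIV] by simp
  obtain C where C: "compact C" "connected C" "C \<subseteq> ?Q" "F constant_on C"
    "\<And>X. connected X \<Longrightarrow> X \<subseteq> ?Q \<Longrightarrow> X \<inter> X1 \<noteq> {} \<Longrightarrow> X \<inter> X2 \<noteq> {} \<Longrightarrow> X \<inter> C \<noteq> {}"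
  proof (rule fibre_joined_or_separated[where F=F and Q="?Q" and \<kappa>="clamp a b"
        and good="thin_sphere (F ` ?Q) A" and ?X1.0=X1 and ?X2.0=X2])
    fix C and S :: "('m \<times> real) set"
    assume S: "finite S" "\<And>m r. (m, r) \<in> S \<Longrightarrow> thin_sphere (F ` ?Q) A m r"
      and CQ: "connected C" "C \<subseteq> ?Q" and sph: "\<And>z. z \<in> C \<Longrightarrow> \<exists>(m, r)\<in>S. dist m (F z) = r"
    have "connected (F ` C)"
      using F CQ continuous_on_subset by (blast intro: connected_continuous_image)
    moreover have "F ` C \<subseteq> (\<Union>(m, r)\<in>S. sphere m r)"
      using sph by fastforce
    ultimately have "F x = F y" if "x \<in> C" "y \<in> C" for x y
      using connected_in_thin_spheres[OF S A(2), of "F ` C" "F x" "F y"] CQ that by blast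
    then show "F constant_on C"
      unfolding constant_on_def by blast
  qed (use F cont clamp exists_thin_sphere[OF K null A(1)] nj X meet in auto)
  have "X3 \<inter> C \<noteq> {}" "X4 \<inter> C \<noteq> {}"
    using C(5)[of X3] C(5)[of X4] X meet by (auto simp: Int_commute)
  then show "fibre_joined F ?Q X3 X4"
    unfolding fibre_joined_def using C(1-4) by (metis Int_commute)
qed

text \<open>Pure unrectifiability is stated for Euclidean \<open>real ^ 2\<close>, so
  \<open>H\<close> is transported there; \<open>d1\<close> is at most twice the Euclidean
  distance.\<close>

lemma hausdorff2_square_image:
  fixes H :: "real \<times> real \<Rightarrow> 'm::metric_space"
  assumes "purely_2_unrectifiable TYPE('m)" and "lipschitz_wrt d1 C unit_square H"
  shows "hausdorff2 (H ` unit_square) = 0"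
proof -
  define f :: "real ^ 2 \<Rightarrow> 'm" where "f v = H (v $ 1, v $ 2)" for v
  define S :: "(real ^ 2) set" where "S = cbox 0 1"
  have S: "v \<in> S \<longleftrightarrow> v $ 1 \<in> unit_I \<and> v $ 2 \<in> unit_I" for v
    by (auto simp: S_def mem_box_cart forall_2)
  have C: "0 \<le> C" "\<And>x y. x \<in> unit_square \<Longrightarrow> y \<in> unit_square \<Longrightarrow> dist (H x) (H y) \<le> C * d1 x y"
    using assms(2) by (auto simp: lipschitz_wrt_def)
  have "(C * 2)-lipschitz_on S f"
  proof (rule lipschitz_onI)
    fix u v assume uv: "u \<in> S" "v \<in> S"
    then have "dist (f u) (f v) \<le> C * d1 (u $ 1, u $ 2) (v $ 1, v $ 2)"
      unfolding f_def using S by (intro C(2)) auto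
    also have "\<dots> \<le> C * (2 * dist u v)"
      using C(1) component_le_norm_cart[of "u - v" 1] component_le_norm_cart[of "u - v" 2]
      by (intro mult_left_mono) (auto simp: d1_def dist_norm)
    finally show "dist (f u) (f v) \<le> C * 2 * dist u v"
      by (simp add: mult.assoc)
  qed (use C in auto)
  moreover have "S \<in> sets borel"
    by (simp add: S_def)
  ultimately have "hausdorff2 (f ` S) = 0"
    using assms(1) unfolding purely_2_unrectifiable_def by blast
  moreover have "f ` S = H ` unit_square"
  proof
    show "f ` S \<subseteq> H ` unit_square"
      using S by (auto simp: f_def)
    show "H ` unit_square \<subseteq> f ` S"
    proof safe
      fix x y :: real assume "x \<in> unit_I" "y \<in> unit_I"
      then have "vector [x, y] \<in> S" "f (vector [x, y]) = H (x, y)"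
        by (auto simp: S f_def)
      then show "H (x, y) \<in> f ` S"
        by (metis image_eqI)
    qed
  qed
  ultimately show ?thesis by simp
qed

section \<open>Length of curves and arc length\<close>

lemma partition_in_unit_I:
  fixes t :: "nat \<Rightarrow> real"
  assumes "t 0 = 0" "t n = 1" "\<forall>i<n. t i \<le> t (Suc i)" "i \<le> n"
  shows "t i \<in> unit_I"
proof -
  have "0 \<le> t i"
    using assms(4)
  proof (induction i)
    case (Suc i)
    then show ?case using assms(3) by (metis Suc_le_eq less_imp_le order_trans)
  qed (simp add: assms(1))
  moreover have "t i \<le> 1"
    using assms(4)
  proof (induction i rule: inc_induct)
    case (step i)
    then show ?case using assms(3) by force
  qed (simp add: assms(2))
  ultimately show ?thesis by simp
qed

lemma curve_length_upper:
  "t 0 = 0 \<Longrightarrow> t n = 1 \<Longrightarrow> \<forall>i<n. t i \<le> t (Suc i) \<Longrightarrow>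
    (\<Sum>i<n. ennreal (dist (\<gamma> (t i)) (\<gamma> (t (Suc i))))) \<le> curve_length \<gamma>"
  unfolding curve_length_def by (rule SUP_upper2[of "(n, t)"]) auto

lemma curve_length_least:
  assumes "\<And>n t. t 0 = 0 \<Longrightarrow> t n = 1 \<Longrightarrow> \<forall>i<n. t i \<le> t (Suc i) \<Longrightarrow>
    (\<Sum>i<n. ennreal (dist (\<gamma> (t i)) (\<gamma> (t (Suc i))))) \<le> B"
  shows "curve_length \<gamma> \<le> B"
  unfolding curve_length_def by (rule SUP_least) (use assms in auto)

lemma curve_length_mono:
  assumes "\<And>s t. s \<in> unit_I \<Longrightarrow> t \<in> unit_I \<Longrightarrow> dist (\<gamma> s) (\<gamma> t) \<le> dist (\<beta> s) (\<beta> t)"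
  shows "curve_length \<gamma> \<le> curve_length \<beta>"
proof (rule curve_length_least)
  fix n and t :: "nat \<Rightarrow> real" assume t: "t 0 = 0" "t n = 1" "\<forall>i<n. t i \<le> t (Suc i)"
  have "(\<Sum>i<n. ennreal (dist (\<gamma> (t i)) (\<gamma> (t (Suc i))))) \<le> (\<Sum>i<n. ennreal (dist (\<beta> (t i)) (\<beta> (t (Suc i)))))"
    using partition_in_unit_I[OF t] by (intro sum_mono ennreal_leI assms) auto
  also have "\<dots> \<le> curve_length \<beta>"
    by (rule curve_length_upper[OF t])
  finally show "(\<Sum>i<n. ennreal (dist (\<gamma> (t i)) (\<gamma> (t (Suc i))))) \<le> curve_length \<beta>" .
qed

lemma curve_length_le_lipschitz:
  assumes "lipschitz_wrt dist C unit_I \<gamma>"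
  shows "curve_length \<gamma> \<le> ennreal C"
proof (rule curve_length_least)
  fix n and t :: "nat \<Rightarrow> real" assume t: "t 0 = 0" "t n = 1" "\<forall>i<n. t i \<le> t (Suc i)"
  have "(\<Sum>i<n. ennreal (dist (\<gamma> (t i)) (\<gamma> (t (Suc i))))) = ennreal (\<Sum>i<n. dist (\<gamma> (t i)) (\<gamma> (t (Suc i))))"
    by (intro sum_ennreal) auto
  also have "(\<Sum>i<n. dist (\<gamma> (t i)) (\<gamma> (t (Suc i)))) \<le> (\<Sum>i<n. C * (t (Suc i) - t i))"
  proof (intro sum_mono)
    fix i assume "i \<in> {..<n}"
    then have "dist (\<gamma> (t i)) (\<gamma> (t (Suc i))) \<le> C * dist (t i) (t (Suc i))"
      using assms partition_in_unit_I[OF t, of i] partition_in_unit_I[OF t, of "Suc i"]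
      by (auto simp: lipschitz_wrt_def)
    then show "dist (\<gamma> (t i)) (\<gamma> (t (Suc i))) \<le> C * (t (Suc i) - t i)"
      using t(3) \<open>i \<in> {..<n}\<close> by (auto simp: dist_real_def)
  qed
  also have "\<dots> = C"
    using t by (simp add: sum_lessThan_telescope flip: sum_distrib_left)
  finally show "(\<Sum>i<n. ennreal (dist (\<gamma> (t i)) (\<gamma> (t (Suc i))))) \<le> ennreal C"
    by (simp add: ennreal_leI)
qed

text \<open>Stopping \<open>\<beta>\<close> at time \<open>s\<close> turns partitions of the unit interval into partitions of \<open>{0..s}\<close>.\<close>

lemma curve_length_stopped_add:
  assumes st: "s \<in> unit_I" "t \<in> unit_I" "s \<le> t"
  shows "curve_length (\<lambda>u. \<beta> (min u s)) + ennreal (dist (\<beta> s) (\<beta> t)) \<le> curve_length (\<lambda>u. \<beta> (min u t))"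
proof -
  let ?I = "{(n :: nat, p :: nat \<Rightarrow> real). p 0 = 0 \<and> p n = 1 \<and> (\<forall>i<n. p i \<le> p (Suc i))}"
  let ?f = "\<lambda>(n, p). \<Sum>i<n. ennreal (dist (\<beta> (min (p i) s)) (\<beta> (min (p (Suc i)) s)))"
  have "(1, real) \<in> ?I"
    by auto
  then have "?I \<noteq> {}"
    by blast
  then have "curve_length (\<lambda>u. \<beta> (min u s)) + ennreal (dist (\<beta> s) (\<beta> t))
      = (SUP x\<in>?I. ?f x + ennreal (dist (\<beta> s) (\<beta> t)))"
    unfolding curve_length_def by (rule ennreal_SUP_add_left[symmetric])
  also have "\<dots> \<le> curve_length (\<lambda>u. \<beta> (min u t))"
  proof (rule SUP_least, clarify)
    fix n :: nat and p :: "nat \<Rightarrow> real"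
    assume p: "p 0 = 0" "p n = 1" "\<forall>i<n. p i \<le> p (Suc i)"
    \<comment> \<open>A partition stopped at \<open>s\<close>, then \<open>t\<close>, then the
      endpoint 1. The step from \<open>s\<close> to \<open>t\<close> adds the new distance; the last
      one adds 0, since the path is already stopped at \<open>t\<close>.\<close>
    define q where "q i = (if i \<le> n then min (p i) s else if i = Suc n then t else 1)" for i
    have q: "min (q i) t = min (p i) s" if "i \<le> n" for i
      using that st by (auto simp: q_def)
    have q_Suc: "q (Suc n) = t"
      by (simp add: q_def)
    have "(\<Sum>i<n. ennreal (dist (\<beta> (min (p i) s)) (\<beta> (min (p (Suc i)) s)))) + ennreal (dist (\<beta> s) (\<beta> t))
      = (\<Sum>i<Suc n. ennreal (dist (\<beta> (min (q i) t)) (\<beta> (min (q (Suc i)) t))))"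
      using st p(2) by (simp add: q q_Suc)
    also have "\<dots> \<le> (\<Sum>i<Suc (Suc n). ennreal (dist (\<beta> (min (q i) t)) (\<beta> (min (q (Suc i)) t))))"
      by simp
    also have "\<dots> \<le> curve_length (\<lambda>u. \<beta> (min u t))"
    proof (rule curve_length_upper)
      show "q 0 = 0" "q (Suc (Suc n)) = 1"
        using st p by (auto simp: q_def)
      show "\<forall>i<Suc (Suc n). q i \<le> q (Suc i)"
      proof safe
        fix i assume "i < Suc (Suc n)"
        then consider "i < n" | "i = n" | "i = Suc n" by linarith
        then show "q i \<le> q (Suc i)"
        proof cases
          case 1
          then have "p i \<le> p (Suc i)" using p by blast
          then show ?thesis using 1 by (auto simp: q_def)
        qed (use st p in \<open>auto simp: q_def\<close>)
      qed
    qed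
    finally show "(\<Sum>i<n. ennreal (dist (\<beta> (min (p i) s)) (\<beta> (min (p (Suc i)) s)))) + ennreal (dist (\<beta> s) (\<beta> t))
      \<le> curve_length (\<lambda>u. \<beta> (min u t))" .
  qed
  finally show ?thesis .
qed

text \<open>\<open>v t\<close> is the length of \<open>\<beta>\<close> stopped at \<open>t\<close>,
  finite because \<open>\<beta>\<close> is Lipschitz. The absolute value matches the cost of a chain
  segment.\<close>

lemma exists_arc_length:
  assumes \<beta>: "lipschitz_path \<beta>"
  obtains v :: "real \<Rightarrow> real" where
    "\<And>s t. s \<in> unit_I \<Longrightarrow> t \<in> unit_I \<Longrightarrow> s \<le> t \<Longrightarrow> dist (\<beta> s) (\<beta> t) \<le> v t - v s"
    "ennreal \<bar>v 0 - v 1\<bar> \<le> curve_length \<beta>"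
proof -
  obtain C where C: "lipschitz_wrt dist C unit_I \<beta>"
    using \<beta> by (auto simp: lipschitz_path_def)
  define l where "l t = curve_length (\<lambda>u. \<beta> (min u t))" for t
  have le: "l t \<le> curve_length \<beta>" if "t \<in> unit_I" for t
  proof -
    have "l t \<le> l 1"
      using curve_length_stopped_add[of t 1 \<beta>] that unfolding l_def
      by (auto elim: order_trans[rotated])
    also have "\<dots> \<le> curve_length \<beta>"
      unfolding l_def by (rule curve_length_mono) (auto simp: min_absorb1)
    finally show ?thesis .
  qed
  have "curve_length \<beta> < top"
    using curve_length_le_lipschitz[OF C] ennreal_less_top[of C] by (rule le_less_trans)
  then have fin: "l t < top" if "t \<in> unit_I" for t
    using le[OF that] by (rule le_less_trans[rotated])
  show thesis
  proof (rule that[of "\<lambda>t. enn2real (l t)"])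
    show step: "dist (\<beta> s) (\<beta> t) \<le> enn2real (l t) - enn2real (l s)"
      if "s \<in> unit_I" "t \<in> unit_I" "s \<le> t" for s t
    proof -
      have "l s + ennreal (dist (\<beta> s) (\<beta> t)) \<le> l t"
        using curve_length_stopped_add[OF that] by (simp add: l_def)
      then have "enn2real (l s + ennreal (dist (\<beta> s) (\<beta> t))) \<le> enn2real (l t)"
        using fin[OF that(2)] by (intro enn2real_mono)
      then show ?thesis
        using fin[OF that(1)] by (simp add: enn2real_plus)
    qed
    have "0 \<le> enn2real (l 1) - enn2real (l 0)"
      using order_trans[OF zero_le_dist step[of 0 1]] by simp
    then have "\<bar>enn2real (l 0) - enn2real (l 1)\<bar> \<le> enn2real (l 1)"
      by simp
    then have "ennreal \<bar>enn2real (l 0) - enn2real (l 1)\<bar> \<le> ennreal (enn2real (l 1))"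
      by (rule ennreal_leI)
    also have "\<dots> = l 1"
      using fin[of 1] by simp
    also have "\<dots> \<le> curve_length \<beta>"
      using le[of 1] by simp
    finally show "ennreal \<bar>enn2real (l 0) - enn2real (l 1)\<bar> \<le> curve_length \<beta>" .
  qed
qed

section \<open>Assembly of the homotopy\<close>

lemma Lip_wrt_le: "lipschitz_wrt d C S f \<Longrightarrow> Lip_wrt d S f \<le> C"
  unfolding Lip_wrt_def
  by (rule cInf_lower) (auto simp: lipschitz_wrt_def intro!: bdd_belowI[of _ 0])

lemma lipschitz_square_continuous:
  assumes "lipschitz_wrt d1 C unit_square H"
  shows "continuous_on unit_square H"
proof -
  have "(C * 2)-lipschitz_on unit_square H"
  proof (rule lipschitz_onI)
    fix x y :: "real \<times> real" assume xy: "x \<in> unit_square" "y \<in> unit_square"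
    have "0 \<le> C"
      using assms by (simp add: lipschitz_wrt_def)
    have "dist (H x) (H y) \<le> C * d1 x y"
      using assms xy unfolding lipschitz_wrt_def by blast
    also have "C * d1 x y \<le> C * (2 * dist x y)"
      using dist_fst_le[of x y] dist_snd_le[of x y] \<open>0 \<le> C\<close>
      by (intro mult_left_mono) (auto simp: d1_def dist_real_def)
    finally show "dist (H x) (H y) \<le> C * 2 * dist x y"
      by (simp add: mult.assoc)
  qed (use assms in \<open>auto simp: lipschitz_wrt_def\<close>)
  then show ?thesis
    by (rule lipschitz_on_continuous_on)
qed

theorem lemma3p8:
  fixes \<gamma> \<beta> :: "real \<Rightarrow> 'm::metric_space"
  assumes "purely_2_unrectifiable TYPE('m)"
    and "lipschitz_path \<gamma>"
    and "lipschitz_path \<beta>"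
    and "homotopic_rel_endpoints \<gamma> \<beta>"
  shows "\<exists>(H' :: real \<times> real \<Rightarrow> 'm) (\<beta>' :: real \<Rightarrow> 'm).
    lipschitz_square H' \<and>
    lipschitz_path \<beta>' \<and>
    homotopy_from_to H' \<gamma> \<beta>' \<and>
    Lip_square H' = Lip_path \<gamma> \<and>
    H' ` unit_square \<subseteq> \<gamma> ` unit_I \<and>
    Lip_path \<beta>' \<le> Lip_path \<gamma> \<and>
    \<beta>' ` unit_I \<subseteq> \<gamma> ` unit_I \<and>
    curve_length \<beta>' \<le> curve_length \<beta>"
proof -
  define L where "L = Lip_path \<gamma>"
  have L: "lipschitz_wrt dist L unit_I \<gamma>"
    using assms(2) Lip_wrt_attained[of dist] by (auto simp: lipschitz_path_def L_def)
  obtain H C where H: "lipschitz_wrt d1 C unit_square H"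
    and H0: "\<And>t. t \<in> unit_I \<Longrightarrow> H (t, 0) = \<gamma> t" and H1: "\<And>t. t \<in> unit_I \<Longrightarrow> H (t, 1) = \<beta> t"
    and Hl: "\<And>s. s \<in> unit_I \<Longrightarrow> H (0, s) = \<gamma> 0" and Hr: "\<And>s. s \<in> unit_I \<Longrightarrow> H (1, s) = \<gamma> 1"
    using assms(4)
    unfolding homotopic_rel_endpoints_def homotopy_from_to_def lipschitz_square_def by blast
  obtain v where v: "\<And>s t. s \<in> unit_I \<Longrightarrow> t \<in> unit_I \<Longrightarrow> s \<le> t \<Longrightarrow> dist (\<beta> s) (\<beta> t) \<le> v t - v s"
    and v01: "ennreal \<bar>v 0 - v 1\<bar> \<le> curve_length \<beta>"
    by (rule exists_arc_length[OF assms(3)]) blast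
  \<comment> \<open>The index \<open>False\<close> is the bottom side of the square, carrying
    \<open>\<gamma>\<close> with weight \<open>L * t\<close>; \<open>True\<close> is the top side,
    carrying \<open>\<beta>\<close> with its arc length.\<close>
  define c :: "bool \<Rightarrow> real \<Rightarrow> real \<times> real" where "c top t = (t, if top then 1 else 0)" for top t
  define w :: "bool \<Rightarrow> real \<Rightarrow> real" where "w top t = (if top then v t else L * t)" for top t
  have square: "unit_square = cbox (0, 0) (1, 1)"
    by (simp add: cbox_Pair_eq)
  interpret chain_space H unit_square c w
  proof
    show "continuous_on unit_I (c i)" for i
      unfolding c_def by (intro continuous_intros)
    show "t \<in> unit_I \<Longrightarrow> c i t \<in> unit_square" for i t
      by (auto simp: c_def)
    show "dist (H (c i s)) (H (c i t)) \<le> w i t - w i s"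
      if "s \<in> unit_I" "t \<in> unit_I" "s \<le> t" for i s t
    proof (cases i)
      case True
      then show ?thesis using v[OF that] that by (simp add: c_def w_def H1)
    next
      case False
      have "dist (\<gamma> s) (\<gamma> t) \<le> L * dist s t"
        using L that by (auto simp: lipschitz_wrt_def)
      then show ?thesis
        using False that by (simp add: c_def w_def H0 dist_real_def algebra_simps)
    qed
    show "fibre_joined H unit_square X1 X2 \<or> fibre_joined H unit_square X3 X4"
      if "\<And>X. X \<in> {X1, X2, X3, X4} \<Longrightarrow> compact X \<and> connected X \<and> X \<subseteq> unit_square"
        "X1 \<inter> X3 \<noteq> {}" "X1 \<inter> X4 \<noteq> {}" "X2 \<inter> X3 \<noteq> {}" "X2 \<inter> X4 \<noteq> {}" for X1 X2 X3 X4
      using four_sets_of_null_image[of "(0, 0)" "(1, 1)" H X1 X2 X3 X4]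
        lipschitz_square_continuous[OF H] hausdorff2_square_image[OF assms(1) H] that
      unfolding square by blast
  qed
  \<comment> \<open>Only points of the bottom side are measured, but the chains between them may
    also use the top side.\<close>
  define \<rho> where "\<rho> s t = rho (c False (max 0 (min 1 s))) (c False (max 0 (min 1 t)))" for s t
  interpret tree: interval_tree \<rho> L
    unfolding \<rho>_def by (rule interval_tree_rho) (simp add: w_def)
  have "dist (\<gamma> s) (\<gamma> t) \<le> \<rho> s t" if "s \<in> unit_I" "t \<in> unit_I" for s t
    using dist_le_rho[OF segment[OF that, of False]] that
    by (simp add: \<rho>_def c_def H0 min_absorb2 max_absorb2)
  then obtain H' where H': "lipschitz_wrt d1 L unit_square H'" "H' ` unit_square \<subseteq> \<gamma> ` unit_I"
      "homotopy_from_to H' \<gamma> (\<lambda>t. H' (t, 1))" "lipschitz_wrt dist (\<rho> 0 1) unit_I (\<lambda>t. H' (t, 1))"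
    using tree.exists_homotopy_to_geodesic[of \<gamma>] by blast
  have \<rho>01: "\<rho> 0 1 \<le> \<bar>v 0 - v 1\<bar>"
  proof -
    \<comment> \<open>\<open>H\<close> is constant on the left and right sides, so these are free
      jumps; from corner to corner one goes up, along \<open>\<beta>\<close>, and down
      again.\<close>
    have "chain (c False 0) (c True 0) ({0} \<times> unit_I) 0" "chain (c True 1) (c False 1) ({1} \<times> unit_I) 0"
      by (rule jump; auto simp: c_def constant_on_def Hl Hr intro!: compact_Times connected_Times)+
    moreover have "chain (c True 0) (c True 1) (c True ` closed_segment 0 1) \<bar>v 0 - v 1\<bar>"
      using segment[of 0 1 True] by (simp add: w_def)
    ultimately have "rho (c False 0) (c False 1) \<le> 0 + (\<bar>v 0 - v 1\<bar> + 0)"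
      by (blast intro: rho_le chain.trans)
    then show ?thesis by (simp add: \<rho>_def)
  qed
  have "Lip_square H' = L"
  proof (rule antisym)
    show "Lip_square H' \<le> L"
      using H'(1) by (rule Lip_wrt_le)
    have att: "lipschitz_wrt d1 (Lip_square H') unit_square H'"
      by (rule Lip_wrt_attained[OF _ H'(1)]) (simp add: d1_def)
    \<comment> \<open>The bottom side of \<open>H'\<close> is \<open>\<gamma>\<close>, and
      \<open>d1\<close> restricts to the usual distance there, so the constant of \<open>H'\<close>
      cannot be smaller than \<open>L\<close>.\<close>
    have "lipschitz_wrt dist (Lip_square H') unit_I \<gamma>"
      unfolding lipschitz_wrt_def
    proof safe
      show "0 \<le> Lip_square H'"
        using att by (simp add: lipschitz_wrt_def)
      fix s t :: real assume st: "s \<in> unit_I" "t \<in> unit_I"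
      then have "dist (H' (s, 0)) (H' (t, 0)) \<le> Lip_square H' * d1 (s, 0) (t, 0)"
        using att by (simp add: lipschitz_wrt_def)
      then show "dist (\<gamma> s) (\<gamma> t) \<le> Lip_square H' * dist s t"
        using H'(3) st by (simp add: homotopy_from_to_def d1_def dist_real_def)
    qed
    then show "L \<le> Lip_square H'"
      unfolding L_def by (rule Lip_wrt_le)
  qed
  moreover have "curve_length (\<lambda>t. H' (t, 1)) \<le> curve_length \<beta>"
    using curve_length_le_lipschitz[OF H'(4)] ennreal_leI[OF \<rho>01] v01 by (meson order_trans)
  moreover have "Lip_path (\<lambda>t. H' (t, 1)) \<le> L"
    using Lip_wrt_le[OF H'(4)] tree.D_le by linarith
  moreover have "(\<lambda>t. H' (t, 1)) ` unit_I \<subseteq> \<gamma> ` unit_I"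
    using H'(2) by auto
  ultimately show ?thesis
    using H' by (intro exI[of _ H'] exI[of _ "\<lambda>t. H' (t, 1)"])
      (auto simp: lipschitz_square_def lipschitz_path_def L_def)
qed

end
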